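(* Let $\Gamma$ be a framed graph and let $\Delta\lessdot\Delta'$ be a covering relation in the framing lattice $\mathcal L_\Gamma$. Then there is exactly one left corner $c$ of $\Gamma$ with $\mathrm{CC}_L(\Delta,c)\neq\mathrm{CC}_L(\Delta',c)$, and for this corner $\mathrm{CC}_L(\Delta,c)<\mathrm{CC}_L(\Delta',c)$.
   Context: A flow graph $G$ is a finite directed acyclic graph with vertex set $[n]$ and a finite multiset of edges, each directed from a smaller to a larger vertex. Sources (resp. sinks) have no incoming (resp. outgoing) edge; other vertices are internal. A route is a directed path from a source to a sink. A framing assigns to every internal vertex $v$ total orders $<_{\mathrm{in}(v)}$ on incoming edges and $<_{\mathrm{out}(v)}$ on outgoing edges of $v$; $\Gamma=(G,F)$ is a framed graph. Routes through an internal vertex $v$ are compared by the outgoing preorder $\le^+_v$ (lexicographic comparison of the suffixes from $v$, using the orders $<_{\mathrm{out}}$) and the incoming preorder $\le^-_v$ (lexicographic comparison of the prefixes ending at $v$, read backwards, using the orders $<_{\mathrm{in}}$). $p$ is clockwise to $q$ at $v$ if $p<^-_v q$ and $p>^+_v q$; routes are coherent if neither is clockwise to the other at any shared internal vertex; if incoherent at $v$, their maximal common subpath containing $v$ is a subroute of conflict. A maximal clique is an inclusion-maximal set of pairwise coherent routes. Adjacent maximal cliques share all but one route; for adjacent $\Delta,\Delta'$ with $r\in\Delta\setminus\Delta'$, $r'\in\Delta'\setminus\Delta$ it is known that $r,r'$ have a unique subroute of conflict $s$. The framing lattice $\mathcal L_\Gamma$ is the lattice on maximal cliques with cover relations $\Delta\lessdot\Delta'$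 for adjacent $\Delta,\Delta'$ with $r$ clockwise to $r'$ at $s$. A left corner is $c=(c^\bullet,c^\downarrow,c^\uparrow)$ with $c^\bullet$ internal and $c^\downarrow<_{\mathrm{in}(c^\bullet)}c^\uparrow$ consecutive incoming edges of $c^\bullet$. A left-cornered route with corner $c$ is the corner $c$ followed by a directed path from $c^\bullet$ to a sink; left-cornered routes with the same corner $c$ are totally ordered by the outgoing order at $c^\bullet$ (lexicographic comparison of their paths from $c^\bullet$ using the orders $<_{\mathrm{out}}$). In a maximal clique $\Delta$, routes through $v$ are totally ordered by $p\preceq q$ iff $p\le^-_vq$ and $p\le^+_vq$; the upper cornering route $r^\uparrow_c(\Delta)$ is the $\preceq$-smallest route of $\Delta$ using $c^\uparrow$ and the lower cornering route $r^\downarrow_c(\Delta)$ is the $\preceq$-largest route of $\Delta$ using $c^\downarrow$ (at $v=c^\bullet$); they coincide after $c^\bullet$, and $\bar s_c(\Delta)$ is the left-cornered route consisting of $c$ followed by this common part. The left cubical coordinate $\mathrm{CC}_L(\Delta,c)$ is the corank of $\bar s_c(\Delta)$ in the outgoing order at $c^\bullet$, i.e. the number of left-cornered routes with corner $c$ strictly greater than $\bar s_c(\Delta)$ in that order. *)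

theory Defs
  imports "Graph_Theory.Arc_Walk"
begin

text \<open>
  The arcs of a \<^typ>\<open>('a, 'b) pre_digraph\<close> are named, so parallel arcs are distinguished and
  a finite arc set represents a finite multiset of edges.
\<close>

locale flow_graph = fin_digraph G for G :: "(nat, 'e) pre_digraph" (structure) +
  fixes n :: nat
  assumes verts_eq: "verts G = {1..n}"
    and tail_less_head: "e \<in> arcs G \<Longrightarrow> tail G e < head G e"
begin

definition source :: "nat \<Rightarrow> bool" where
  "source v \<longleftrightarrow> v \<in> verts G \<and> in_arcs G v = {}"

definition sink :: "nat \<Rightarrow> bool" where
  "sink v \<longleftrightarrow> v \<in> verts G \<and> out_arcs G v = {}"

definition internal :: "nat \<Rightarrow> bool" where
  "internal v \<longleftrightarrow> v \<in> verts G \<and> \<not> source v \<and> \<not> sink v"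

text \<open>
  A directed path is given by its first vertex and its list of arcs; the first vertex is recorded
  because a path (for instance a subroute of conflict) may consist of a single vertex.
\<close>

definition path_verts :: "nat \<times> 'e list \<Rightarrow> nat set" where
  "path_verts p = set (awalk_verts (fst p) (snd p))"

definition route :: "nat \<times> 'e list \<Rightarrow> bool" where
  "route p \<longleftrightarrow> (\<exists>w. awalk (fst p) (snd p) w \<and> source (fst p) \<and> sink w)"

definition subpath :: "nat \<times> 'e list \<Rightarrow> nat \<times> 'e list \<Rightarrow> bool" where
  "subpath s p \<longleftrightarrow> (\<exists>x y. snd p = x @ snd s @ y \<and> awalk (fst p) x (fst s))"

text \<open>
  Vertices strictly increase along a path, so the arcs before the one with tail \<open>v\<close> form the
  part ending at \<open>v\<close>, and the remaining ones the part starting at \<open>v\<close>. Both functions are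
  only used for an internal vertex \<open>v\<close> on a route.
\<close>

definition prefix_to :: "nat \<Rightarrow> nat \<times> 'e list \<Rightarrow> 'e list" where
  "prefix_to v p = takeWhile (\<lambda>e. tail G e \<noteq> v) (snd p)"

definition suffix_from :: "nat \<Rightarrow> nat \<times> 'e list \<Rightarrow> 'e list" where
  "suffix_from v p = dropWhile (\<lambda>e. tail G e \<noteq> v) (snd p)"

end

text \<open>
  The relations \<open>in_ord v\<close> and \<open>out_ord v\<close> are the strict orders on the incoming and the
  outgoing arcs of \<open>v\<close>; their values at non-internal vertices are irrelevant.
\<close>

locale framed_graph = flow_graph G n for G :: "(nat, 'e) pre_digraph" (structure) and n :: nat +
  fixes in_ord out_ord :: "nat \<Rightarrow> 'e rel"
  assumes in_ord_subset: "internal v \<Longrightarrow> in_ord v \<subseteq> in_arcs G v \<times> in_arcs G v"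
    and in_ord_linear: "internal v \<Longrightarrow> strict_linear_order_on (in_arcs G v) (in_ord v)"
    and out_ord_subset: "internal v \<Longrightarrow> out_ord v \<subseteq> out_arcs G v \<times> out_arcs G v"
    and out_ord_linear: "internal v \<Longrightarrow> strict_linear_order_on (out_arcs G v) (out_ord v)"
begin

text \<open>
  Two paths from \<open>v\<close> to sinks first differ in arcs with the same tail, so the lexicographic order
  of their arc lists over the union of all outgoing orders is the intended comparison; the
  proper-prefix case of \<^const>\<open>lexord\<close> cannot occur. Dually for paths from sources to \<open>v\<close>,
  read backwards.
\<close>

definition out_lex :: "'e list rel" where
  "out_lex = lexord (\<Union>v\<in>{v. internal v}. out_ord v)"

definition in_lex :: "'e list rel" where
  "in_lex = {(x, y). (rev x, rev y) \<in> lexord (\<Union>v\<in>{v. internal v}. in_ord v)}"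

definition out_less :: "nat \<Rightarrow> nat \<times> 'e list \<Rightarrow> nat \<times> 'e list \<Rightarrow> bool" where
  "out_less v p q \<longleftrightarrow> (suffix_from v p, suffix_from v q) \<in> out_lex"

definition in_less :: "nat \<Rightarrow> nat \<times> 'e list \<Rightarrow> nat \<times> 'e list \<Rightarrow> bool" where
  "in_less v p q \<longleftrightarrow> (prefix_to v p, prefix_to v q) \<in> in_lex"

definition out_le :: "nat \<Rightarrow> nat \<times> 'e list \<Rightarrow> nat \<times> 'e list \<Rightarrow> bool" where
  "out_le v p q \<longleftrightarrow> out_less v p q \<or> suffix_from v p = suffix_from v q"

definition in_le :: "nat \<Rightarrow> nat \<times> 'e list \<Rightarrow> nat \<times> 'e list \<Rightarrow> bool" where
  "in_le v p q \<longleftrightarrow> in_less v p q \<or> prefix_to v p = prefix_to v q"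

definition shared_internal :: "nat \<times> 'e list \<Rightarrow> nat \<times> 'e list \<Rightarrow> nat \<Rightarrow> bool" where
  "shared_internal p q v \<longleftrightarrow> internal v \<and> v \<in> path_verts p \<and> v \<in> path_verts q"

definition clockwise_at :: "nat \<Rightarrow> nat \<times> 'e list \<Rightarrow> nat \<times> 'e list \<Rightarrow> bool" where
  "clockwise_at v p q \<longleftrightarrow> shared_internal p q v \<and> in_less v p q \<and> out_less v q p"

definition coherent :: "nat \<times> 'e list \<Rightarrow> nat \<times> 'e list \<Rightarrow> bool" where
  "coherent p q \<longleftrightarrow>
    (\<forall>v. shared_internal p q v \<longrightarrow> \<not> clockwise_at v p q \<and> \<not> clockwise_at v q p)"

definition common_subpath ::
    "nat \<times> 'e list \<Rightarrow> nat \<times> 'e list \<Rightarrow> nat \<Rightarrow> nat \<times> 'e list \<Rightarrow> bool" where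
  "common_subpath p q v s \<longleftrightarrow> subpath s p \<and> subpath s q \<and> v \<in> path_verts s"

definition conflict_subroute ::
    "nat \<times> 'e list \<Rightarrow> nat \<times> 'e list \<Rightarrow> nat \<Rightarrow> nat \<times> 'e list \<Rightarrow> bool" where
  "conflict_subroute p q v s \<longleftrightarrow>
    (clockwise_at v p q \<or> clockwise_at v q p) \<and> common_subpath p q v s \<and>
    (\<forall>s'. common_subpath p q v s' \<and> subpath s s' \<longrightarrow> s' = s)"

definition clockwise_at_subroute ::
    "nat \<times> 'e list \<Rightarrow> nat \<times> 'e list \<Rightarrow> nat \<times> 'e list \<Rightarrow> bool" where
  "clockwise_at_subroute s p q \<longleftrightarrow> (\<exists>v. clockwise_at v p q \<and> conflict_subroute p q v s)"

definition clique :: "(nat \<times> 'e list) set \<Rightarrow> bool" where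
  "clique D \<longleftrightarrow> (\<forall>p\<in>D. route p) \<and> (\<forall>p\<in>D. \<forall>q\<in>D. coherent p q)"

definition maximal_clique :: "(nat \<times> 'e list) set \<Rightarrow> bool" where
  "maximal_clique D \<longleftrightarrow> clique D \<and> (\<forall>D'. clique D' \<and> D \<subseteq> D' \<longrightarrow> D' = D)"

text \<open>
  The order of the framing lattice is the reflexive transitive closure of this relation. The
  subroute of conflict of \<open>r\<close> and \<open>r'\<close> is unique for adjacent maximal cliques, so the
  existential quantifier over \<open>s\<close> involves no choice.
\<close>

definition framing_cover :: "(nat \<times> 'e list) set \<Rightarrow> (nat \<times> 'e list) set \<Rightarrow> bool" where
  "framing_cover D D' \<longleftrightarrow>
    maximal_clique D \<and> maximal_clique D' \<and>
    (\<exists>r r' s. D - D' = {r} \<and> D' - D = {r'} \<and> clockwise_at_subroute s r r')"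

text \<open>A corner \<open>(v, a, b)\<close> consists of its vertex, its lower arc and its upper arc.\<close>

fun left_corner :: "nat \<times> 'e \<times> 'e \<Rightarrow> bool" where
  "left_corner (v, a, b) \<longleftrightarrow>
    internal v \<and> (a, b) \<in> in_ord v \<and> (\<nexists>e. (a, e) \<in> in_ord v \<and> (e, b) \<in> in_ord v)"

text \<open>A left-cornered route is represented by its corner and the arcs of its path to a sink.\<close>

definition left_cornered_routes ::
    "nat \<times> 'e \<times> 'e \<Rightarrow> ((nat \<times> 'e \<times> 'e) \<times> 'e list) set" where
  "left_cornered_routes c = {(c, t) | t. \<exists>w. awalk (fst c) t w \<and> sink w}"

definition route_le :: "nat \<Rightarrow> nat \<times> 'e list \<Rightarrow> nat \<times> 'e list \<Rightarrow> bool" where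
  "route_le v p q \<longleftrightarrow> in_le v p q \<and> out_le v p q"

fun upper_cornering_route ::
    "(nat \<times> 'e list) set \<Rightarrow> nat \<times> 'e \<times> 'e \<Rightarrow> nat \<times> 'e list" where
  "upper_cornering_route D (v, a, b) =
    (THE r. r \<in> D \<and> b \<in> set (snd r) \<and> (\<forall>q\<in>D. b \<in> set (snd q) \<longrightarrow> route_le v r q))"

fun lower_cornering_route ::
    "(nat \<times> 'e list) set \<Rightarrow> nat \<times> 'e \<times> 'e \<Rightarrow> nat \<times> 'e list" where
  "lower_cornering_route D (v, a, b) =
    (THE r. r \<in> D \<and> a \<in> set (snd r) \<and> (\<forall>q\<in>D. a \<in> set (snd q) \<longrightarrow> route_le v q r))"

definition left_cornered_route_of ::
    "(nat \<times> 'e list) set \<Rightarrow> nat \<times> 'e \<times> 'e \<Rightarrow> (nat \<times> 'e \<times> 'e) \<times> 'e list" where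
  "left_cornered_route_of D c =
    (c, THE t. suffix_from (fst c) (upper_cornering_route D c) = t \<and>
               suffix_from (fst c) (lower_cornering_route D c) = t)"

definition CC_L :: "(nat \<times> 'e list) set \<Rightarrow> nat \<times> 'e \<times> 'e \<Rightarrow> nat" where
  "CC_L D c =
    card {\<sigma> \<in> left_cornered_routes c. (snd (left_cornered_route_of D c), snd \<sigma>) \<in> out_lex}"

end

end

theory Submission
  imports Defs
begin

text \<open>
  Let \<open>r\<close> and \<open>r'\<close> be the exchanged routes. Splicing \<open>r\<close> up to the first vertex \<open>x\<close> of conflict with
  \<open>r'\<close> from there on gives a route coherent with all of \<open>D'\<close>, hence lying in \<open>D\<close>, hence coherent with
  \<open>r\<close>; so all conflicts of \<open>r\<close> and \<open>r'\<close> lie on one common subpath starting at \<open>x\<close>. Let \<open>a\<close> and \<open>b\<close> be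
  the arcs of \<open>r\<close> and \<open>r'\<close> into \<open>x\<close>. They are consecutive, since a maximal clique has a route through
  every arc and a route entering \<open>x\<close> strictly between \<open>a\<close> and \<open>b\<close> would conflict with \<open>r\<close> or \<open>r'\<close>.
  Coherence of the common routes with \<open>r\<close> and \<open>r'\<close> makes \<open>r\<close> the lower cornering route of \<open>D\<close> and \<open>r'\<close>
  the upper cornering route of \<open>D'\<close> at \<open>(x, a, b)\<close>, and \<open>r\<close> leaves \<open>x\<close> above \<open>r'\<close>, so the coordinate
  increases. At any other corner the upper and lower cornering routes agree after the corner, so a
  change of coordinate would replace both of them; then \<open>r\<close> and \<open>r'\<close> use the two arcs of that corner
  and conflict there, which is only possible at \<open>(x, a, b)\<close>.
\<close>

section \<open>Abstract systems of routes\<close>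

text \<open>Only one vertex of conflict is extracted from the cover relation. That all conflicts of
  the exchanged routes share one subpath is derived from the splice: a common route conflicting with
  it at \<open>x\<close> would, by transitivity, conflict with \<open>r\<close> or
  \<open>r'\<close>, and minimality of \<open>x\<close> excludes conflicts with \<open>r'\<close>
  before \<open>x\<close>. The delicate ingredient is that a maximal clique uses every arc. Sources
  and sinks do not occur in the axioms. An internal vertex is one with an arc entering and an arc
  leaving, and \<open>through_out\<close> and \<open>through_in\<close> say that a route ends only
  where no route goes on and starts only where no route arrives.\<close>

text \<open>
  A route is seen through its set of arcs. Vertices are integers so that the system can be reversed by
  negating all vertex labels and exchanging \<open>Out\<close> with \<open>In\<close>: the assumptions are invariant under this
  reversal, and every fact about suffixes has a dual about prefixes.
\<close>

locale route_system =
  fixes R :: "'r set" and arcs_of :: "'r \<Rightarrow> 'e set" and T H :: "'e \<Rightarrow> int" and Out In :: "'e rel"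
  assumes finite_routes: "finite R"
    and finite_arcs: "p \<in> R \<Longrightarrow> finite (arcs_of p)"
    and arc_less: "p \<in> R \<Longrightarrow> e \<in> arcs_of p \<Longrightarrow> T e < H e"
    and chain: "p \<in> R \<Longrightarrow> e \<in> arcs_of p \<Longrightarrow> f \<in> arcs_of p \<Longrightarrow> e = f \<or> H e \<le> T f \<or> H f \<le> T e"
    and link_out: "p \<in> R \<Longrightarrow> e \<in> arcs_of p \<Longrightarrow> f \<in> arcs_of p \<Longrightarrow> H e \<le> T f \<Longrightarrow> \<exists>g\<in>arcs_of p. T g = H e"
    and link_in: "p \<in> R \<Longrightarrow> e \<in> arcs_of p \<Longrightarrow> f \<in> arcs_of p \<Longrightarrow> H e \<le> T f \<Longrightarrow> \<exists>g\<in>arcs_of p. H g = T f"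
    and through_out: "p \<in> R \<Longrightarrow> q \<in> R \<Longrightarrow> e \<in> arcs_of p \<Longrightarrow> f \<in> arcs_of q \<Longrightarrow> H e = T f
      \<Longrightarrow> \<exists>g\<in>arcs_of p. T g = H e"
    and through_in: "p \<in> R \<Longrightarrow> q \<in> R \<Longrightarrow> e \<in> arcs_of p \<Longrightarrow> f \<in> arcs_of q \<Longrightarrow> H e = T f
      \<Longrightarrow> \<exists>g\<in>arcs_of q. H g = T f"
    and route_eqI: "p \<in> R \<Longrightarrow> q \<in> R \<Longrightarrow> arcs_of p = arcs_of q \<Longrightarrow> p = q"
    and splice_exists: "p \<in> R \<Longrightarrow> q \<in> R \<Longrightarrow> (\<exists>e\<in>arcs_of p. H e = v) \<Longrightarrow> (\<exists>e\<in>arcs_of p. T e = v)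
      \<Longrightarrow> (\<exists>e\<in>arcs_of q. H e = v) \<Longrightarrow> (\<exists>e\<in>arcs_of q. T e = v)
      \<Longrightarrow> \<exists>r\<in>R. arcs_of r = {e\<in>arcs_of p. T e < v} \<union> {e\<in>arcs_of q. v \<le> T e}"
    and Out_arcs: "(e, f) \<in> Out \<Longrightarrow> T e = T f \<and> (\<exists>p\<in>R. \<exists>g\<in>arcs_of p. H g = T e) \<and> e \<in> \<Union>(arcs_of ` R) \<and> f \<in> \<Union>(arcs_of ` R)"
    and In_arcs: "(e, f) \<in> In \<Longrightarrow> H e = H f \<and> (\<exists>p\<in>R. \<exists>g\<in>arcs_of p. T g = H e) \<and> e \<in> \<Union>(arcs_of ` R) \<and> f \<in> \<Union>(arcs_of ` R)"
    and Out_irrefl: "(e, e) \<notin> Out"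
    and In_irrefl: "(e, e) \<notin> In"
    and Out_trans: "(e, f) \<in> Out \<Longrightarrow> (f, g) \<in> Out \<Longrightarrow> (e, g) \<in> Out"
    and In_trans: "(e, f) \<in> In \<Longrightarrow> (f, g) \<in> In \<Longrightarrow> (e, g) \<in> In"
    and Out_total: "p \<in> R \<Longrightarrow> q \<in> R \<Longrightarrow> e \<in> arcs_of p \<Longrightarrow> f \<in> arcs_of q \<Longrightarrow> T e = T f
      \<Longrightarrow> \<exists>g\<in>arcs_of p. H g = T e \<Longrightarrow> e \<noteq> f \<Longrightarrow> (e, f) \<in> Out \<or> (f, e) \<in> Out"
    and In_total: "p \<in> R \<Longrightarrow> q \<in> R \<Longrightarrow> e \<in> arcs_of p \<Longrightarrow> f \<in> arcs_of q \<Longrightarrow> H e = H f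
      \<Longrightarrow> \<exists>g\<in>arcs_of p. T g = H e \<Longrightarrow> e \<noteq> f \<Longrightarrow> (e, f) \<in> In \<or> (f, e) \<in> In"
begin

text \<open>For a route \<open>p\<close> of a graph this says that \<open>p\<close> visits \<open>v\<close> and \<open>v\<close> is internal.\<close>

definition through :: "'r \<Rightarrow> int \<Rightarrow> bool" where
  "through p v \<longleftrightarrow> (\<exists>e\<in>arcs_of p. H e = v) \<and> (\<exists>e\<in>arcs_of p. T e = v)"

text \<open>Lexicographic comparison of suffixes without lists: vertices increase along a route, so
  having the same arcs with tail between \<open>v\<close> and \<open>T e\<close> replaces equality
  of the initial segments before the first difference.\<close>

definition out_lt :: "int \<Rightarrow> 'r \<Rightarrow> 'r \<Rightarrow> bool" where
  "out_lt v p q \<longleftrightarrow> (\<exists>e\<in>arcs_of p. \<exists>f\<in>arcs_of q. T e = T f \<and> v \<le> T e \<and> (e, f) \<in> Out \<and>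
     (\<forall>g. v \<le> T g \<and> T g < T e \<longrightarrow> (g \<in> arcs_of p \<longleftrightarrow> g \<in> arcs_of q)))"

definition in_lt :: "int \<Rightarrow> 'r \<Rightarrow> 'r \<Rightarrow> bool" where
  "in_lt v p q \<longleftrightarrow> (\<exists>e\<in>arcs_of p. \<exists>f\<in>arcs_of q. H e = H f \<and> H e \<le> v \<and> (e, f) \<in> In \<and>
     (\<forall>g. H g \<le> v \<and> H e < H g \<longrightarrow> (g \<in> arcs_of p \<longleftrightarrow> g \<in> arcs_of q)))"

definition out_eq :: "int \<Rightarrow> 'r \<Rightarrow> 'r \<Rightarrow> bool" where
  "out_eq v p q \<longleftrightarrow> (\<forall>g. v \<le> T g \<longrightarrow> (g \<in> arcs_of p \<longleftrightarrow> g \<in> arcs_of q))"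

definition in_eq :: "int \<Rightarrow> 'r \<Rightarrow> 'r \<Rightarrow> bool" where
  "in_eq v p q \<longleftrightarrow> (\<forall>g. H g \<le> v \<longrightarrow> (g \<in> arcs_of p \<longleftrightarrow> g \<in> arcs_of q))"

definition agree :: "int \<Rightarrow> int \<Rightarrow> 'r \<Rightarrow> 'r \<Rightarrow> bool" where
  "agree v w p q \<longleftrightarrow> (\<forall>g. v \<le> T g \<and> T g < w \<longrightarrow> (g \<in> arcs_of p \<longleftrightarrow> g \<in> arcs_of q))"

text \<open>Counts arcs by heads, which makes it the mirror image of \<open>agree\<close>. By
  \<open>agree_in_iff\<close> the two coincide for routes through both end vertices.\<close>

definition agree_in :: "int \<Rightarrow> int \<Rightarrow> 'r \<Rightarrow> 'r \<Rightarrow> bool" where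
  "agree_in v w p q \<longleftrightarrow> (\<forall>g. H g \<le> w \<and> v < H g \<longrightarrow> (g \<in> arcs_of p \<longleftrightarrow> g \<in> arcs_of q))"

definition clockwise :: "int \<Rightarrow> 'r \<Rightarrow> 'r \<Rightarrow> bool" where
  "clockwise v p q \<longleftrightarrow> through p v \<and> through q v \<and> in_lt v p q \<and> out_lt v q p"

definition conflict :: "int \<Rightarrow> 'r \<Rightarrow> 'r \<Rightarrow> bool" where
  "conflict v p q \<longleftrightarrow> clockwise v p q \<or> clockwise v q p"

definition coherent :: "'r \<Rightarrow> 'r \<Rightarrow> bool" where
  "coherent p q \<longleftrightarrow> (\<forall>v. \<not> conflict v p q)"

definition clique :: "'r set \<Rightarrow> bool" where
  "clique D \<longleftrightarrow> D \<subseteq> R \<and> (\<forall>p\<in>D. \<forall>q\<in>D. coherent p q)"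

text \<open>Testing single routes suffices for maximality under inclusion, since coherence is
  symmetric and every route is coherent with itself.\<close>

definition maximal_clique :: "'r set \<Rightarrow> bool" where
  "maximal_clique D \<longleftrightarrow> clique D \<and> (\<forall>p\<in>R. (\<forall>q\<in>D. coherent p q) \<longrightarrow> p \<in> D)"

definition le :: "int \<Rightarrow> 'r \<Rightarrow> 'r \<Rightarrow> bool" where
  "le v p q \<longleftrightarrow> (in_lt v p q \<or> in_eq v p q) \<and> (out_lt v p q \<or> out_eq v p q)"

text \<open>Apart from exchanging dual axioms, only splicing needs an argument: reversal cuts routes
  by heads instead of tails and exchanges the two halves. Both cuts agree on a route through the cut
  vertex.\<close>

lemma dual: "route_system R arcs_of (\<lambda>e. - H e) (\<lambda>e. - T e) In Out"
proof (unfold_locales, goal_cases)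
  case (4 p e f) then show ?case using chain[of p e f] by auto
next
  case (5 p e f) then show ?case using link_in[of p f e] by auto
next
  case (6 p e f) then show ?case using link_out[of p f e] by auto
next
  case (7 p q e f) then show ?case using through_in[of q p f e] by auto
next
  case (8 p q e f) then show ?case using through_out[of q p f e] by auto
next
  case (11 e f) then show ?case using In_arcs[of e f] by (auto, blast)
next
  case (12 e f) then show ?case using Out_arcs[of e f] by (auto, blast)
next
  case (10 p q v)
  from 10(3-6) have "\<exists>e\<in>arcs_of p. H e = - v" "\<exists>e\<in>arcs_of p. T e = - v"
    "\<exists>e\<in>arcs_of q. H e = - v" "\<exists>e\<in>arcs_of q. T e = - v"
    by (metis minus_minus)+
  note ex = this
  obtain r where r: "r \<in> R" "arcs_of r = {e\<in>arcs_of q. T e < - v} \<union> {e\<in>arcs_of p. - v \<le> T e}"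
    using splice_exists[OF 10(2,1) ex(3,4,1,2)] by blast
  have *: "T e < - v \<longleftrightarrow> H e \<le> - v"
    if e: "e \<in> arcs_of p'" and p': "p' \<in> R" and a: "a \<in> arcs_of p'" "H a = - v"
      and b: "b \<in> arcs_of p'" "T b = - v" for e p' a b
    using chain[OF p' e a(1)] chain[OF p' e b(1)] arc_less[OF p' e] arc_less[OF p' a(1)] arc_less[OF p' b(1)] a b
    by (smt (verit))
  have pv: "T e < - v \<longleftrightarrow> H e \<le> - v" if "e \<in> arcs_of p" for e
    using ex(1,2) * [OF that 10(1)] by blast
  have qv: "T e < - v \<longleftrightarrow> H e \<le> - v" if "e \<in> arcs_of q" for e
    using ex(3,4) * [OF that 10(2)] by blast
  have "arcs_of r = {e\<in>arcs_of p. - H e < v} \<union> {e\<in>arcs_of q. v \<le> - H e}"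
  proof -
    have "v \<le> - H e \<longleftrightarrow> H e \<le> - v" "- H e < v \<longleftrightarrow> \<not> H e \<le> - v" "- v \<le> T e \<longleftrightarrow> \<not> T e < - v" for e
      by linarith+
    then show ?thesis using pv qv unfolding r(2) by blast
  qed
  then show ?case using r(1) by blast
qed (auto simp: finite_routes finite_arcs arc_less Out_irrefl In_irrefl
      intro: Out_trans In_trans route_eqI dest: Out_arcs In_arcs, (metis In_total, metis Out_total))

section \<open>The outgoing order at a vertex\<close>

lemma finite_in_routes: "D \<subseteq> R \<Longrightarrow> finite D" using finite_routes finite_subset by blast

lemma unique_tail: "p \<in> R \<Longrightarrow> e \<in> arcs_of p \<Longrightarrow> f \<in> arcs_of p \<Longrightarrow> T e = T f \<Longrightarrow> e = f"
  using chain[of p e f] arc_less[of p] by fastforce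

lemma unique_head: "p \<in> R \<Longrightarrow> e \<in> arcs_of p \<Longrightarrow> f \<in> arcs_of p \<Longrightarrow> H e = H f \<Longrightarrow> e = f"
  using chain[of p e f] arc_less[of p] by fastforce

text \<open>No arc of a route can pass over a vertex of that route, so cutting the route by tails
  and cutting it by heads give the same parts.\<close>

lemma through_less_iff:
  assumes "p \<in> R" "through p v" "e \<in> arcs_of p" shows "T e < v \<longleftrightarrow> H e \<le> v"
proof -
  obtain a b where "a \<in> arcs_of p" "H a = v" "b \<in> arcs_of p" "T b = v"
    using assms unfolding through_def by blast
  then show ?thesis using chain[OF assms(1,3), of a] chain[OF assms(1,3), of b] arc_less[OF assms(1)] assms(3)
    by (smt (verit))
qed

lemma agree_in_iff:
  assumes "p \<in> R" "through p v" "through p w" "q \<in> R" "through q v" "through q w"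
  shows "agree_in v w p q \<longleftrightarrow> agree v w p q"
  using through_less_iff[OF assms(1,2)] through_less_iff[OF assms(1,3)]
    through_less_iff[OF assms(4,5)] through_less_iff[OF assms(4,6)]
  unfolding agree_in_def agree_def by (meson not_less)

lemma out_lt_irrefl: "p \<in> R \<Longrightarrow> \<not> out_lt v p p"
  unfolding out_lt_def using unique_tail Out_irrefl by metis

lemma out_lt_trans:
  assumes "p \<in> R" "q \<in> R" "r \<in> R" "out_lt v p q" "out_lt v q r" shows "out_lt v p r"
proof -
  obtain a b where ab: "a \<in> arcs_of p" "b \<in> arcs_of q" "T a = T b" "v \<le> T a" "(a, b) \<in> Out"
    and pq: "\<forall>g. v \<le> T g \<and> T g < T a \<longrightarrow> (g \<in> arcs_of p \<longleftrightarrow> g \<in> arcs_of q)"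
    using assms unfolding out_lt_def by blast
  obtain c d where cd: "c \<in> arcs_of q" "d \<in> arcs_of r" "T c = T d" "v \<le> T c" "(c, d) \<in> Out"
    and qr: "\<forall>g. v \<le> T g \<and> T g < T c \<longrightarrow> (g \<in> arcs_of q \<longleftrightarrow> g \<in> arcs_of r)"
    using assms unfolding out_lt_def by blast
  consider "T a < T c" | "T a = T c" | "T c < T a" by linarith
  then show ?thesis
  proof cases
    case 1
    then have "b \<in> arcs_of r" using qr ab by simp
    moreover have "\<forall>g. v \<le> T g \<and> T g < T a \<longrightarrow> (g \<in> arcs_of p \<longleftrightarrow> g \<in> arcs_of r)"
      using 1 pq qr by simp
    ultimately show ?thesis unfolding out_lt_def using ab by blast
  next
    case 2
    then have "b = c" using unique_tail[OF assms(2), of b c] ab cd by simp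
    then have "(a, d) \<in> Out" using Out_trans ab cd by blast
    moreover have "\<forall>g. v \<le> T g \<and> T g < T a \<longrightarrow> (g \<in> arcs_of p \<longleftrightarrow> g \<in> arcs_of r)"
      using pq qr 2 by simp
    moreover have "T a = T d" using 2 cd by simp
    ultimately show ?thesis unfolding out_lt_def using ab cd by blast
  next
    case 3
    then have "c \<in> arcs_of p" using pq cd by simp
    moreover have "\<forall>g. v \<le> T g \<and> T g < T c \<longrightarrow> (g \<in> arcs_of p \<longleftrightarrow> g \<in> arcs_of r)"
      using 3 pq qr by simp
    ultimately show ?thesis unfolding out_lt_def using cd by blast
  qed
qed

lemma out_lt_total:
  assumes pq: "p \<in> R" "q \<in> R" and v: "through p v" "through q v"
  shows "out_lt v p q \<or> out_eq v p q \<or> out_lt v q p"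
proof (rule ccontr)
  assume contra: "\<not> ?thesis"
  \<comment> \<open>The tails of the arcs that lie on exactly one of the two routes after
    \<open>v\<close>; the least one is the vertex where the routes part.\<close>
  define S where "S = T ` ({g\<in>arcs_of p \<union> arcs_of q. v \<le> T g} - (arcs_of p \<inter> arcs_of q))"
  have fin: "finite S" using finite_arcs pq by (auto simp: S_def)
  have ne: "S \<noteq> {}" using contra by (auto simp: S_def out_eq_def)
  define k where "k = Min S"
  have kS: "k \<in> S" using fin ne by (simp add: k_def)
  have kmin: "g \<in> arcs_of p \<longleftrightarrow> g \<in> arcs_of q" if "v \<le> T g" "T g < k" for g
  proof (rule ccontr)
    assume "\<not> ?thesis"
    then have "T g \<in> S" using that by (auto simp: S_def)
    then show False using that Min_le[OF fin] by (fastforce simp: k_def)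
  qed
  have main: False if h: "p' \<in> R" "q' \<in> R" "through p' v" "through q' v" "g \<in> arcs_of p'" "g \<notin> arcs_of q'" "T g = k"
     "\<not> out_lt v p' q'" "\<not> out_lt v q' p'" "\<forall>g. v \<le> T g \<longrightarrow> T g < k \<longrightarrow> (g \<in> arcs_of p' \<longleftrightarrow> g \<in> arcs_of q')" for p' q' g
  proof -
    have vk: "v \<le> k" using kS by (auto simp: S_def)
    have set: "(\<forall>g. v \<le> T g \<and> T g < k \<longrightarrow> (g \<in> arcs_of p' \<longleftrightarrow> g \<in> arcs_of q'))" using h(10) by blast
    \<comment> \<open>The order \<open>Out\<close> can decide only if both routes leave
      \<open>k\<close>. If \<open>k\<close> is not \<open>v\<close>, the arc of \<open>p'\<close>
      entering \<open>k\<close> starts before \<open>k\<close>, so it also lies on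
      \<open>q'\<close>, and \<open>q'\<close> continues because \<open>g\<close> shows that
      \<open>k\<close> is not an end of routes.\<close>
    have "(\<exists>f\<in>arcs_of q'. T f = k) \<and> (\<exists>e\<in>arcs_of p'. H e = k)"
    proof (cases "v = k")
      case True then show ?thesis using h unfolding through_def by blast
    next
      case False
      obtain a where a: "a \<in> arcs_of p'" "T a = v" using h(3) unfolding through_def by blast
      have "H a \<le> T g" using chain[OF h(1) a(1) h(5)] a False vk h(7) arc_less[OF h(1) h(5)] by auto
      then obtain e where e: "e \<in> arcs_of p'" "H e = k" using link_in[OF h(1) a(1) h(5)] h(7) by auto
      have "T e < k" using arc_less[OF h(1) e(1)] e by simp
      have "v \<le> T e" using chain[OF h(1) a(1) e(1)] a e False vk arc_less[OF h(1) a(1)] by auto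
      then have "e \<in> arcs_of q'" using h(10) \<open>T e < k\<close> e by blast
      then have "\<exists>f\<in>arcs_of q'. T f = k" using through_out[OF h(2,1) _ h(5), of e] e h(7) by auto
      then show ?thesis using e by blast
    qed
    then obtain f e where f: "f \<in> arcs_of q'" "T f = k" "e \<in> arcs_of p'" "H e = k" by blast
    then have "f \<noteq> g" using h by auto
    then have "(g, f) \<in> Out \<or> (f, g) \<in> Out" using Out_total[OF h(1,2,5) f(1)] h f by auto
    then show False
    proof
      assume "(g, f) \<in> Out"
      then have "out_lt v p' q'" unfolding out_lt_def using set f(1,2) h(5,7) vk
        by (intro bexI[of _ g] bexI[of _ f]) auto
      then show False using h(8) by simp
    next
      assume "(f, g) \<in> Out"
      then have "out_lt v q' p'" unfolding out_lt_def using set f(1,2) h(5,7) vk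
        by (intro bexI[of _ f] bexI[of _ g]) auto
      then show False using h(9) by simp
    qed
  qed
  obtain g where "T g = k" "g \<in> arcs_of p \<and> g \<notin> arcs_of q \<or> g \<in> arcs_of q \<and> g \<notin> arcs_of p"
    using kS unfolding S_def by blast
  then show False using main[of p q g] main[of q p g] assms contra kmin by auto
qed

text \<open>The two deciding arcs are distinct with a common tail, so neither lies on both routes,
  and they cannot start where the routes agree.\<close>

lemma out_lt_step:
  assumes "p \<in> R" "q \<in> R" "v \<le> w" "agree v w p q"
  shows "out_lt v p q \<longleftrightarrow> out_lt w p q"
proof
  assume "out_lt v p q"
  then obtain a b where 1: "a \<in> arcs_of p" "b \<in> arcs_of q" "T a = T b" "v \<le> T a" "(a, b) \<in> Out"
    "(\<forall>g. v \<le> T g \<and> T g < T a \<longrightarrow> (g \<in> arcs_of p \<longleftrightarrow> g \<in> arcs_of q))"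
    unfolding out_lt_def by blast
  have "w \<le> T a"
  proof (rule ccontr)
    assume "\<not> w \<le> T a"
    then have "a \<in> arcs_of q" using assms(4) 1 unfolding agree_def by auto
    then show False using unique_tail[OF assms(2), of a b] 1 Out_irrefl by metis
  qed
  moreover have "(\<forall>g. w \<le> T g \<and> T g < T a \<longrightarrow> (g \<in> arcs_of p \<longleftrightarrow> g \<in> arcs_of q))"
    using 1(6) assms(3) by simp
  ultimately show "out_lt w p q" using 1 unfolding out_lt_def by blast
next
  assume "out_lt w p q"
  then obtain a b where 1: "a \<in> arcs_of p" "b \<in> arcs_of q" "T a = T b" "w \<le> T a" "(a, b) \<in> Out"
    "(\<forall>g. w \<le> T g \<and> T g < T a \<longrightarrow> (g \<in> arcs_of p \<longleftrightarrow> g \<in> arcs_of q))"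
    unfolding out_lt_def by blast
  have "g \<in> arcs_of p \<longleftrightarrow> g \<in> arcs_of q" if "v \<le> T g" "T g < T a" for g
  proof (cases "T g < w")
    case True then show ?thesis using assms(4) that unfolding agree_def by blast
  next
    case False then show ?thesis using 1(6) that by (auto simp: not_less)
  qed
  then have "(\<forall>g. v \<le> T g \<and> T g < T a \<longrightarrow> (g \<in> arcs_of p \<longleftrightarrow> g \<in> arcs_of q))" by blast
  moreover have "v \<le> T a" using 1 assms(3) by simp
  ultimately show "out_lt v p q" using 1 unfolding out_lt_def by blast
qed

text \<open>The counterpart of \<open>out_lt_step\<close>: once the routes differ before
  \<open>w\<close>, the comparison is decided there, and what happens from \<open>w\<close> on may
  be changed freely.\<close>

lemma out_lt_congD:
  assumes "agree v w p p'" "agree v w q q'" "\<not> agree v w p q" "out_lt v p q"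
  shows "out_lt v p' q'"
proof -
  obtain a b where 1: "a \<in> arcs_of p" "b \<in> arcs_of q" "T a = T b" "v \<le> T a" "(a, b) \<in> Out"
    "(\<forall>g. v \<le> T g \<and> T g < T a \<longrightarrow> (g \<in> arcs_of p \<longleftrightarrow> g \<in> arcs_of q))"
    using assms unfolding out_lt_def by blast
  have aw: "T a < w"
  proof (rule ccontr)
    assume "\<not> T a < w"
    then have "agree v w p q" using 1(6) unfolding agree_def by simp
    then show False using assms by simp
  qed
  have *: "g \<in> arcs_of p \<longleftrightarrow> g \<in> arcs_of p'" "g \<in> arcs_of q \<longleftrightarrow> g \<in> arcs_of q'" if "v \<le> T g" "T g < w" for g
    using that assms unfolding agree_def by blast+
  have "(\<forall>g. v \<le> T g \<and> T g < T a \<longrightarrow> (g \<in> arcs_of p' \<longleftrightarrow> g \<in> arcs_of q'))"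
    using 1(6) * aw by simp
  moreover have "a \<in> arcs_of p'" "b \<in> arcs_of q'" using * 1 aw by auto
  ultimately show ?thesis using 1 unfolding out_lt_def by blast
qed

lemma agree_sym: "agree v w p q \<longleftrightarrow> agree v w q p" unfolding agree_def by blast
lemma agree_refl [simp]: "agree v w p p" unfolding agree_def by blast
lemma agree_trans: "agree v w p q \<Longrightarrow> agree v w q r \<Longrightarrow> agree v w p r" unfolding agree_def by blast

lemma out_lt_cong:
  assumes "agree v w p p'" "agree v w q q'" "\<not> agree v w p q"
  shows "out_lt v p q \<longleftrightarrow> out_lt v p' q'"
  using out_lt_congD[OF assms] out_lt_congD[of v w p' p q' q] assms agree_sym agree_trans by blast

section \<open>Transport along reversal\<close>

lemma dual_simps:
  "route_system.through arcs_of (\<lambda>e. - H e) (\<lambda>e. - T e) p (- v) \<longleftrightarrow> through p v"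
  "route_system.out_lt arcs_of (\<lambda>e. - H e) In (- v) p q \<longleftrightarrow> in_lt v p q"
  "route_system.in_lt arcs_of (\<lambda>e. - T e) Out (- v) p q \<longleftrightarrow> out_lt v p q"
  "route_system.out_eq arcs_of (\<lambda>e. - H e) (- v) p q \<longleftrightarrow> in_eq v p q"
  "route_system.in_eq arcs_of (\<lambda>e. - T e) (- v) p q \<longleftrightarrow> out_eq v p q"
  "route_system.agree arcs_of (\<lambda>e. - H e) (- w) (- v) p q \<longleftrightarrow> agree_in v w p q"
  "route_system.agree_in arcs_of (\<lambda>e. - T e) (- w) (- v) p q \<longleftrightarrow> agree v w p q"
  "route_system.clockwise arcs_of (\<lambda>e. - H e) (\<lambda>e. - T e) In Out (- v) p q \<longleftrightarrow> clockwise v q p"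
  "route_system.conflict arcs_of (\<lambda>e. - H e) (\<lambda>e. - T e) In Out (- v) p q \<longleftrightarrow> conflict v p q"
  "route_system.coherent arcs_of (\<lambda>e. - H e) (\<lambda>e. - T e) In Out p q \<longleftrightarrow> coherent p q"
  "route_system.clique R arcs_of (\<lambda>e. - H e) (\<lambda>e. - T e) In Out D \<longleftrightarrow> clique D"
proof -
  interpret d: route_system R arcs_of "\<lambda>e. - H e" "\<lambda>e. - T e" In Out by (rule dual)
  show through: "d.through p (- v) \<longleftrightarrow> through p v" for p v
    unfolding d.through_def through_def by auto
  show out_lt: "d.out_lt (- v) p q \<longleftrightarrow> in_lt v p q" for v p q
    unfolding d.out_lt_def in_lt_def by simp
  show in_lt: "d.in_lt (- v) p q \<longleftrightarrow> out_lt v p q" for v p q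
    unfolding d.in_lt_def out_lt_def by simp
  show "d.out_eq (- v) p q \<longleftrightarrow> in_eq v p q"
    unfolding d.out_eq_def in_eq_def by simp
  show "d.in_eq (- v) p q \<longleftrightarrow> out_eq v p q"
    unfolding d.in_eq_def out_eq_def by simp
  show "d.agree (- w) (- v) p q \<longleftrightarrow> agree_in v w p q"
    unfolding d.agree_def agree_in_def by simp
  show "d.agree_in (- w) (- v) p q \<longleftrightarrow> agree v w p q"
    unfolding d.agree_in_def agree_def by simp
  \<comment> \<open>Reversal exchanges the incoming and the outgoing order, so the arguments swap;
    conflict and coherence, being symmetric, are preserved.\<close>
  show clockwise: "d.clockwise (- v) p q \<longleftrightarrow> clockwise v q p" for v p q
    unfolding d.clockwise_def clockwise_def by (auto simp: through out_lt in_lt)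
  show conflict: "d.conflict (- v) p q \<longleftrightarrow> conflict v p q" for v p q
    unfolding d.conflict_def conflict_def by (auto simp: clockwise)
  show coherent: "d.coherent p q \<longleftrightarrow> coherent p q" for p q
    unfolding d.coherent_def coherent_def using conflict by (metis minus_minus)
  show "d.clique D \<longleftrightarrow> clique D"
    unfolding d.clique_def clique_def by (simp add: coherent)
qed

lemma in_lt_irrefl: "p \<in> R \<Longrightarrow> \<not> in_lt v p p"
  and in_lt_trans: "p \<in> R \<Longrightarrow> q \<in> R \<Longrightarrow> r \<in> R \<Longrightarrow> in_lt v p q \<Longrightarrow> in_lt v q r \<Longrightarrow> in_lt v p r"
  and in_lt_total: "p \<in> R \<Longrightarrow> q \<in> R \<Longrightarrow> through p v \<Longrightarrow> through q v
    \<Longrightarrow> in_lt v p q \<or> in_eq v p q \<or> in_lt v q p"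
  and in_lt_step: "p \<in> R \<Longrightarrow> q \<in> R \<Longrightarrow> v \<le> w \<Longrightarrow> agree_in v w p q \<Longrightarrow> in_lt w p q \<longleftrightarrow> in_lt v p q"
  and in_lt_cong: "agree_in v w p p' \<Longrightarrow> agree_in v w q q' \<Longrightarrow> \<not> agree_in v w p q
    \<Longrightarrow> in_lt w p q \<longleftrightarrow> in_lt w p' q'"
proof -
  interpret d: route_system R arcs_of "\<lambda>e. - H e" "\<lambda>e. - T e" In Out by (rule dual)
  show "p \<in> R \<Longrightarrow> \<not> in_lt v p p" using d.out_lt_irrefl[of p "- v"] by (simp add: dual_simps)
  show "p \<in> R \<Longrightarrow> q \<in> R \<Longrightarrow> r \<in> R \<Longrightarrow> in_lt v p q \<Longrightarrow> in_lt v q r \<Longrightarrow> in_lt v p r"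
    using d.out_lt_trans[of p q r "- v"] by (simp add: dual_simps)
  show "p \<in> R \<Longrightarrow> q \<in> R \<Longrightarrow> through p v \<Longrightarrow> through q v
    \<Longrightarrow> in_lt v p q \<or> in_eq v p q \<or> in_lt v q p"
    using d.out_lt_total[of p q "- v"] by (simp add: dual_simps)
  show "p \<in> R \<Longrightarrow> q \<in> R \<Longrightarrow> v \<le> w \<Longrightarrow> agree_in v w p q \<Longrightarrow> in_lt w p q \<longleftrightarrow> in_lt v p q"
    using d.out_lt_step[of p q "- w" "- v"] by (simp add: dual_simps)
  show "agree_in v w p p' \<Longrightarrow> agree_in v w q q' \<Longrightarrow> \<not> agree_in v w p q
    \<Longrightarrow> in_lt w p q \<longleftrightarrow> in_lt w p' q'"
    using d.out_lt_cong[of "- w" "- v" p p' q q'] by (simp add: dual_simps)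
qed

lemma out_eq_refl [simp]: "out_eq v p p" and in_eq_refl [simp]: "in_eq v p p"
  unfolding out_eq_def in_eq_def by auto
lemma out_eq_sym: "out_eq v p q \<Longrightarrow> out_eq v q p" and in_eq_sym: "in_eq v p q \<Longrightarrow> in_eq v q p"
  unfolding out_eq_def in_eq_def by auto
lemma out_eq_trans: "out_eq v p q \<Longrightarrow> out_eq v q r \<Longrightarrow> out_eq v p r"
  and in_eq_trans: "in_eq v p q \<Longrightarrow> in_eq v q r \<Longrightarrow> in_eq v p r"
  unfolding out_eq_def in_eq_def by auto

lemma out_lt_out_eq:
  assumes "out_eq v p p'" "out_eq v q q'" shows "out_lt v p q \<longleftrightarrow> out_lt v p' q'"
proof -
  have *: "out_lt v p' q'" if "out_lt v p q" "out_eq v p p'" "out_eq v q q'" for p q p' q'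
  proof -
    obtain e f where "e \<in> arcs_of p" "f \<in> arcs_of q" "T e = T f" "v \<le> T e" "(e, f) \<in> Out"
      "\<forall>g. v \<le> T g \<and> T g < T e \<longrightarrow> (g \<in> arcs_of p \<longleftrightarrow> g \<in> arcs_of q)"
      using \<open>out_lt v p q\<close> unfolding out_lt_def by blast
    then show ?thesis using that(2,3) unfolding out_lt_def out_eq_def
      by (intro bexI[of _ e] bexI[of _ f]) simp_all
  qed
  show ?thesis using *[of p q p' q'] *[of p' q' p q] assms out_eq_sym by blast
qed

lemma in_lt_in_eq:
  assumes "in_eq v p p'" "in_eq v q q'" shows "in_lt v p q \<longleftrightarrow> in_lt v p' q'"
proof -
  interpret d: route_system R arcs_of "\<lambda>e. - H e" "\<lambda>e. - T e" In Out by (rule dual)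
  show ?thesis using d.out_lt_out_eq[of "- v" p p' q q'] assms by (simp add: dual_simps)
qed

section \<open>Splicing two routes at a vertex\<close>

definition is_splice :: "int \<Rightarrow> 'r \<Rightarrow> 'r \<Rightarrow> 'r \<Rightarrow> bool" where
  "is_splice v p q r \<longleftrightarrow> p \<in> R \<and> q \<in> R \<and> r \<in> R \<and> through p v \<and> through q v \<and> in_eq v r p \<and> out_eq v r q"

lemma splice:
  assumes "p \<in> R" "q \<in> R" "through p v" "through q v"
  obtains r where "is_splice v p q r"
proof -
  obtain r where r: "r \<in> R" "arcs_of r = {e\<in>arcs_of p. T e < v} \<union> {e\<in>arcs_of q. v \<le> T e}"
    using splice_exists[OF assms(1,2), of v] assms(3,4) unfolding through_def by auto
  have "in_eq v r p" unfolding in_eq_def r(2)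
    using through_less_iff[OF assms(1,3)] through_less_iff[OF assms(2,4)] by (auto simp: not_less[symmetric])
  moreover have "out_eq v r q" unfolding out_eq_def r(2) by auto
  ultimately show ?thesis using that assms r unfolding is_splice_def by blast
qed

text \<open>This is why splices are described by equal prefixes and suffixes rather than by an arc
  set: reversal then merely exchanges \<open>p\<close> and \<open>q\<close>.\<close>

lemma is_splice_dual:
  "route_system.is_splice R arcs_of (\<lambda>e. - H e) (\<lambda>e. - T e) (- v) p q r \<longleftrightarrow> is_splice v q p r"
proof -
  interpret d: route_system R arcs_of "\<lambda>e. - H e" "\<lambda>e. - T e" In Out by (rule dual)
  show ?thesis unfolding d.is_splice_def is_splice_def by (auto simp: dual_simps)
qed

lemma is_splice_through: "is_splice v p q r \<Longrightarrow> through r v"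
  unfolding is_splice_def through_def in_eq_def out_eq_def by (metis order_refl)

lemma in_eq_mono: "in_eq v p q \<Longrightarrow> w \<le> v \<Longrightarrow> in_eq w p q"
  unfolding in_eq_def by auto
lemma out_eq_mono: "out_eq v p q \<Longrightarrow> v \<le> w \<Longrightarrow> out_eq w p q"
  unfolding out_eq_def by auto

lemma in_eq_agree: "p \<in> R \<Longrightarrow> q \<in> R \<Longrightarrow> through p v \<Longrightarrow> through q v \<Longrightarrow> in_eq v p q \<Longrightarrow> agree w v p q"
  unfolding in_eq_def agree_def using through_less_iff by blast

lemma through_before:
  assumes "p \<in> R" "r \<in> R" "through p v" "through r v" "in_eq v r p" "w < v" "through r w"
  shows "through p w"
proof -
  obtain a b where ab: "a \<in> arcs_of r" "H a = w" "b \<in> arcs_of r" "T b = w"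
    using assms unfolding through_def by blast
  then have "H b \<le> v" using through_less_iff[OF assms(2,4), of b] assms(6) by simp
  then show ?thesis using ab assms(5) less_imp_le[OF assms(6)] unfolding through_def in_eq_def by blast
qed

text \<open>
  If \<open>r\<close> and \<open>t\<close> agree between \<open>w\<close> and \<open>v\<close>, the conflict moves to \<open>v\<close>; otherwise it is decided before
  \<open>v\<close>, where \<open>r\<close> coincides with \<open>p\<close>.
\<close>

lemma conflict_splice_before:
  assumes s: "is_splice v p q r" and t: "t \<in> R" and w: "w < v" "conflict w r t"
  shows "conflict w p t \<or> conflict v r t"
proof -
  have pqr: "p \<in> R" "q \<in> R" "r \<in> R" "through p v" "through q v" "in_eq v r p" "out_eq v r q"
    using s unfolding is_splice_def by auto
  have rv: "through r v" using is_splice_through s by blast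
  have rw: "through r w" "through t w" using w unfolding conflict_def clockwise_def by auto
  have pw: "through p w" using through_before[OF pqr(1,3,4) rv pqr(6) w(1) rw(1)] .
  have inw: "in_eq w r p" using in_eq_mono pqr(6) w by auto
  have ag: "agree w v r p" using in_eq_agree pqr rv by blast
  show ?thesis
  proof (cases "agree w v r t")
    case True
    have tv: "through t v"
    proof -
      obtain a where a: "a \<in> arcs_of r" "H a = v" using rv unfolding through_def by blast
      have "w \<le> T a" using through_less_iff[OF pqr(3) rw(1) a(1)] a w by auto
      moreover have "T a < v" using a arc_less pqr by auto
      ultimately have "a \<in> arcs_of t" using True a unfolding agree_def by blast
      moreover obtain b where "b \<in> arcs_of p" "T b = v" using pqr unfolding through_def by blast
      ultimately have "\<exists>g\<in>arcs_of t. T g = v" using through_out[OF t pqr(1), of a b] a by auto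
      then show ?thesis using \<open>a \<in> arcs_of t\<close> a unfolding through_def by blast
    qed
    have ain: "agree_in w v r t" "agree_in w v t r"
      using True agree_in_iff pqr t rv tv rw agree_sym by blast+
    have "out_lt w r t \<longleftrightarrow> out_lt v r t" "out_lt w t r \<longleftrightarrow> out_lt v t r"
      "in_lt v r t \<longleftrightarrow> in_lt w r t" "in_lt v t r \<longleftrightarrow> in_lt w t r"
      using out_lt_step in_lt_step pqr t w True ain agree_sym less_imp_le by metis+
    then have "conflict v r t" using w(2) rv tv unfolding conflict_def clockwise_def by blast
    then show ?thesis ..
  next
    case False
    have "out_lt w r t \<longleftrightarrow> out_lt w p t" "out_lt w t r \<longleftrightarrow> out_lt w t p"
      using out_lt_cong[OF ag agree_refl False] out_lt_cong[OF agree_refl ag, of t] False agree_sym by blast+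
    moreover have "in_lt w r t \<longleftrightarrow> in_lt w p t" "in_lt w t r \<longleftrightarrow> in_lt w t p"
      using in_lt_in_eq inw in_eq_refl by blast+
    ultimately have "conflict w p t" using w(2) pw unfolding conflict_def clockwise_def by blast
    then show ?thesis ..
  qed
qed

lemma conflict_splice_after:
  assumes s: "is_splice v p q r" and t: "t \<in> R" and w: "v < w" "conflict w r t"
  shows "conflict w q t \<or> conflict v r t"
proof -
  interpret d: route_system R arcs_of "\<lambda>e. - H e" "\<lambda>e. - T e" In Out by (rule dual)
  show ?thesis using d.conflict_splice_before[of "- v" q p r t "- w"] assms
    by (simp add: dual_simps is_splice_dual)
qed

lemma conflict_sym: "conflict v p q \<longleftrightarrow> conflict v q p" unfolding conflict_def by blast
lemma coherent_sym: "coherent p q \<longleftrightarrow> coherent q p" unfolding coherent_def using conflict_sym by blast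
lemma coherent_refl: "p \<in> R \<Longrightarrow> coherent p p"
  unfolding coherent_def conflict_def clockwise_def using in_lt_irrefl by blast

text \<open>A conflict of the splice away from \<open>v\<close> is either inherited from
  \<open>p\<close> or \<open>q\<close>, or slides along a common part to \<open>v\<close>. Hence
  \<open>v\<close> is the only vertex to be checked.\<close>

lemma coherent_splice:
  assumes "is_splice v p q r" "t \<in> R" "coherent p t" "coherent q t" "\<not> conflict v r t"
  shows "coherent r t"
  unfolding coherent_def
proof
  fix w show "\<not> conflict w r t"
    using conflict_splice_before[OF assms(1,2), of w] conflict_splice_after[OF assms(1,2), of w] assms(3-5)
    unfolding coherent_def by (cases w v rule: linorder_cases) auto
qed

lemma conflict_splice_at:
  assumes "is_splice v p q r"
  shows "conflict v r t \<longleftrightarrow> through t v \<and> (in_lt v p t \<and> out_lt v t q \<or> in_lt v t p \<and> out_lt v q t)"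
proof -
  have "in_eq v r p" "out_eq v r q" using assms unfolding is_splice_def by auto
  then have "in_lt v r t = in_lt v p t" "in_lt v t r = in_lt v t p"
     "out_lt v r t = out_lt v q t" "out_lt v t r = out_lt v t q"
    using in_lt_in_eq out_lt_out_eq by auto
  then show ?thesis using is_splice_through[OF assms] unfolding conflict_def clockwise_def by auto
qed

section \<open>The order on coherent routes through a vertex\<close>

lemma coherentD:
  assumes "coherent p q" "through p v" "through q v"
  shows "\<not> (in_lt v p q \<and> out_lt v q p)" "\<not> (in_lt v q p \<and> out_lt v p q)"
  using assms unfolding coherent_def conflict_def clockwise_def by blast+

lemma le_trans:
  assumes "p \<in> R" "q \<in> R" "r \<in> R" "le v p q" "le v q r" shows "le v p r"
proof -
  have "in_lt v p r \<or> in_eq v p r" using assms(4,5) in_lt_trans[OF assms(1-3), of v]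
    in_lt_in_eq[of v p p q r] in_lt_in_eq[of v p q r r] in_eq_trans[of v p q r]
    unfolding le_def by auto
  moreover have "out_lt v p r \<or> out_eq v p r" using assms(4,5) out_lt_trans[OF assms(1-3), of v]
    out_lt_out_eq[of v p p q r] out_lt_out_eq[of v p q r r] out_eq_trans[of v p q r]
    unfolding le_def by auto
  ultimately show ?thesis unfolding le_def by blast
qed

lemma le_refl: "le v p p" unfolding le_def by simp

lemma le_antisym:
  assumes "p \<in> R" "q \<in> R" "through p v" "through q v" "le v p q" "le v q p" shows "p = q"
proof -
  have "in_eq v p q" using assms(5,6) in_lt_trans[OF assms(1,2,1), of v] in_lt_irrefl[OF assms(1), of v]
    in_eq_sym[of v q p] unfolding le_def by blast
  moreover have "out_eq v p q" using assms(5,6) out_lt_trans[OF assms(1,2,1), of v] out_lt_irrefl[OF assms(1), of v]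
    out_eq_sym[of v q p] unfolding le_def by blast
  ultimately have "g \<in> arcs_of p \<longleftrightarrow> g \<in> arcs_of q" for g
    using through_less_iff[OF assms(1,3), of g] through_less_iff[OF assms(2,4), of g]
    unfolding in_eq_def out_eq_def by force
  then show ?thesis using route_eqI assms by blast
qed

text \<open>Both comparisons are total, and coherence says exactly that they never disagree
  strictly.\<close>

lemma le_total:
  assumes "p \<in> R" "q \<in> R" "through p v" "through q v" "coherent p q" shows "le v p q \<or> le v q p"
  using in_lt_total[OF assms(1-4)] out_lt_total[OF assms(1-4)] coherentD[OF assms(5,3,4)]
  unfolding le_def using in_eq_sym out_eq_sym by blast

lemma least_route:
  assumes X: "X \<subseteq> R" "X \<noteq> {}" "\<forall>p\<in>X. through p v" "\<forall>p\<in>X. \<forall>q\<in>X. coherent p q"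
  obtains m where "m \<in> X" "\<forall>q\<in>X. le v m q"
proof -
  have "finite X" using finite_in_routes X by blast
  from this X(2) X have "\<exists>m\<in>X. \<forall>q\<in>X. le v m q"
  proof (induction X rule: finite_ne_induct)
    case (singleton x) then show ?case using le_refl by auto
  next
    case (insert x F)
    then obtain m where m: "m \<in> F" "\<forall>q\<in>F. le v m q" by auto
    then have "le v m x \<or> le v x m" using le_total[of m x v] insert.prems by auto
    moreover have "\<forall>q\<in>F. le v x q" if "le v x m" using that m le_trans[of x m _ v] insert.prems by blast
    ultimately show ?case using m le_refl by blast
  qed
  then show ?thesis using that by blast
qed

lemma greatest_route:
  assumes X: "X \<subseteq> R" "X \<noteq> {}" "\<forall>p\<in>X. through p v" "\<forall>p\<in>X. \<forall>q\<in>X. coherent p q"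
  obtains m where "m \<in> X" "\<forall>q\<in>X. le v q m"
proof -
  have "finite X" using finite_in_routes X by blast
  from this X(2) X have "\<exists>m\<in>X. \<forall>q\<in>X. le v q m"
  proof (induction X rule: finite_ne_induct)
    case (singleton x) then show ?case using le_refl by auto
  next
    case (insert x F)
    then obtain m where m: "m \<in> F" "\<forall>q\<in>F. le v q m" by auto
    then have "le v m x \<or> le v x m" using le_total[of m x v] insert.prems by auto
    moreover have "\<forall>q\<in>F. le v q x" if "le v m x" using that m le_trans[of _ m x v] insert.prems by blast
    ultimately show ?case using m le_refl by blast
  qed
  then show ?thesis using that by blast
qed

lemma through_after:
  assumes "q \<in> R" "r \<in> R" "through q v" "through r v" "out_eq v r q" "v < w" "through r w"
  shows "through q w"
proof -
  interpret d: route_system R arcs_of "\<lambda>e. - H e" "\<lambda>e. - T e" In Out by (rule dual)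
  show ?thesis using d.through_before[of q r "- v" "- w"] assms by (simp add: dual_simps)
qed

lemma through_arc:
  assumes "p \<in> R" "e \<in> arcs_of p" "q \<in> R" "g \<in> arcs_of q" "T g = H e"
  shows "through p (H e)"
  using through_out[OF assms(1,3,2,4)] assms unfolding through_def by auto

text \<open>Prefixes are read backwards, so the arcs entering \<open>v\<close> are compared first
  and decide whenever they differ.\<close>

lemma in_lt_iff_arcs:
  assumes "p \<in> R" "q \<in> R" "a \<in> arcs_of p" "b \<in> arcs_of q" "H a = v" "H b = v" "a \<noteq> b"
  shows "in_lt v p q \<longleftrightarrow> (a, b) \<in> In"
proof
  assume "in_lt v p q"
  then obtain e f where ef: "e \<in> arcs_of p" "f \<in> arcs_of q" "H e = H f" "H e \<le> v" "(e, f) \<in> In"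
      "\<forall>g. H g \<le> v \<and> H e < H g \<longrightarrow> (g \<in> arcs_of p \<longleftrightarrow> g \<in> arcs_of q)"
    unfolding in_lt_def by blast
  have "\<not> H e < v"
  proof
    assume "H e < v"
    then have "a \<in> arcs_of q" using ef(6) assms by auto
    then show False using unique_head[OF assms(2), of a b] assms by auto
  qed
  then have "e = a" "f = b" using unique_head[OF assms(1), of e a] unique_head[OF assms(2), of f b] ef assms by auto
  then show "(a, b) \<in> In" using ef by simp
next
  assume "(a, b) \<in> In"
  then show "in_lt v p q" unfolding in_lt_def using assms by (intro bexI[of _ a] bexI[of _ b]) auto
qed

section \<open>Maximal cliques use every arc\<close>

lemma cliqueD: "clique D \<Longrightarrow> p \<in> D \<Longrightarrow> p \<in> R" "clique D \<Longrightarrow> p \<in> D \<Longrightarrow> q \<in> D \<Longrightarrow> coherent p q"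
  unfolding clique_def by auto

lemma first_touched:
  assumes D: "clique D" and p0: "p0 \<in> R" "e \<in> arcs_of p0" and unused: "\<forall>q\<in>D. e \<notin> arcs_of q"
    and touched: "\<exists>w \<ge> H e. through p0 w \<and> (\<exists>q\<in>D. through q w)"
  obtains v f where "v \<ge> H e" "through p0 v" "\<exists>q\<in>D. through q v"
    "f \<in> arcs_of p0" "H f = v" "\<forall>q\<in>D. f \<notin> arcs_of q"
    "\<forall>w. H e \<le> w \<and> w < v \<and> through p0 w \<longrightarrow> \<not> (\<exists>q\<in>D. through q w)"
proof -
  define W where "W = {w. H e \<le> w \<and> through p0 w \<and> (\<exists>q\<in>D. through q w)}"
  have "W \<subseteq> H ` arcs_of p0" unfolding W_def through_def by auto
  then have fin: "finite W" using finite_arcs[OF p0(1)] finite_surj by blast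
  have ne: "W \<noteq> {}" using touched unfolding W_def by auto
  define v where "v = Min W"
  have vW: "v \<in> W" using fin ne by (simp add: v_def)
  have min: "w \<notin> W" if "w < v" for w using Min_le[OF fin, of w] that v_def by auto
  obtain f where f: "f \<in> arcs_of p0" "H f = v" using vW unfolding W_def through_def by blast
  have "f \<notin> arcs_of q" if q: "q \<in> D" for q
  proof
    assume fq: "f \<in> arcs_of q"
    then have "f \<noteq> e" using unused q by auto
    moreover have "\<not> H f \<le> T e" using f vW arc_less[OF p0] unfolding W_def by auto
    ultimately have le: "H e \<le> T f" using chain[OF p0 f(1)] by auto
    have "\<exists>g\<in>arcs_of p0. H g = T f" using link_in[OF p0(1,2) f(1) le] .
    then obtain g where g: "g \<in> arcs_of p0" "H g = T f" by blast
    have qR: "q \<in> R" using cliqueD D q by blast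
    have "through p0 (T f)" using g f unfolding through_def by blast
    moreover have "through q (T f)" using through_in[OF p0(1) qR g(1) fq g(2)] fq unfolding through_def by blast
    ultimately have "T f \<in> W" using le q unfolding W_def by blast
    then show False using min[of "T f"] f arc_less[OF p0(1) f(1)] by simp
  qed
  moreover have "\<forall>w. H e \<le> w \<and> w < v \<and> through p0 w \<longrightarrow> \<not> (\<exists>q\<in>D. through q w)"
    using min unfolding W_def by blast
  ultimately show ?thesis using that[of v f] vW f unfolding W_def by blast
qed

text \<open>
  The suffix is taken from the greatest route entering \<open>v\<close> below \<open>f\<close>, or, if there is none, from the
  least route entering \<open>v\<close> above \<open>f\<close>.
\<close>

lemma coherent_suffix:
  assumes D: "clique D" and p0: "p0 \<in> R" "f \<in> arcs_of p0" "H f = v" "through p0 v" and unused: "\<forall>q\<in>D. f \<notin> arcs_of q"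
    and touched: "\<exists>q\<in>D. through q v"
  obtains m where "m \<in> D" "through m v"
    "\<forall>q\<in>D. through q v \<longrightarrow> \<not> (in_lt v p0 q \<and> out_lt v q m) \<and> \<not> (in_lt v q p0 \<and> out_lt v m q)"
proof -
  define X where "X = {q\<in>D. through q v}"
  define Lo where "Lo = {q\<in>X. in_lt v q p0}"
  have XR: "X \<subseteq> R" using D cliqueD unfolding X_def by blast
  have thr: "\<forall>q\<in>X. through q v" unfolding X_def by blast
  have coh: "\<forall>p\<in>X. \<forall>q\<in>X. coherent p q" using D cliqueD unfolding X_def by blast
  have cmp: "in_lt v q p0 \<or> in_lt v p0 q" if qX: "q \<in> X" for q
  proof -
    have qR: "q \<in> R" using qX XR by blast
    obtain g where g: "g \<in> arcs_of q" "H g = v" using qX unfolding X_def through_def by blast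
    then have "g \<noteq> f" using unused qX unfolding X_def by blast
    moreover have "\<exists>h\<in>arcs_of p0. T h = H f" using p0 unfolding through_def by blast
    ultimately have "(f, g) \<in> In \<or> (g, f) \<in> In"
      using In_total[OF p0(1) qR p0(2) g(1)] g p0(3) by auto
    then show ?thesis using in_lt_iff_arcs[OF p0(1) qR p0(2) g(1) p0(3) g(2)]
       in_lt_iff_arcs[OF qR p0(1) g(1) p0(2) g(2) p0(3)] \<open>g \<noteq> f\<close> by auto
  qed
  show ?thesis
  proof (cases "Lo = {}")
    case False
    have "Lo \<subseteq> R" "\<forall>p\<in>Lo. through p v" "\<forall>p\<in>Lo. \<forall>q\<in>Lo. coherent p q"
      using XR thr coh unfolding Lo_def by auto
    then obtain m where m: "m \<in> Lo" "\<forall>q\<in>Lo. le v q m" using greatest_route[of Lo v] False by metis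
    have mX: "m \<in> X" "in_lt v m p0" using m unfolding Lo_def by auto
    have "\<not> (in_lt v p0 q \<and> out_lt v q m) \<and> \<not> (in_lt v q p0 \<and> out_lt v m q)" if q: "q \<in> X" for q
    proof -
      have qm: "q \<in> R" "m \<in> R" "through q v" "through m v" "coherent q m" using q mX XR thr coh by auto
      \<comment> \<open>By transitivity through \<open>p0\<close>, the route \<open>m\<close> enters
        below \<open>q\<close>, so coherence forbids \<open>q\<close> to leave below
        \<open>m\<close>.\<close>
      have "\<not> out_lt v q m" if "in_lt v p0 q"
        using in_lt_trans[OF qm(2) p0(1) qm(1) mX(2) that] coherentD[OF qm(5,3,4)] by blast
      moreover have "\<not> out_lt v m q" if "in_lt v q p0"
      proof -
        have "le v q m" using m that q unfolding Lo_def by blast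
        then show ?thesis unfolding le_def
          using out_lt_trans[OF qm(2,1,2)] out_lt_irrefl[OF qm(2)] out_lt_out_eq[of v m m q m] by auto
      qed
      ultimately show ?thesis by blast
    qed
    then show ?thesis using that[of m] mX unfolding X_def by blast
  next
    case True
    then have hi: "\<forall>q\<in>X. \<not> in_lt v q p0" unfolding Lo_def by blast
    have "X \<noteq> {}" using touched unfolding X_def by blast
    then obtain m where m: "m \<in> X" "\<forall>q\<in>X. le v m q" using least_route[OF XR _ thr coh] by metis
    have "\<not> out_lt v q m" if q: "q \<in> X" for q
    proof -
      have qm: "q \<in> R" "m \<in> R" using q m XR by auto
      have "le v m q" using m q by blast
      then show ?thesis unfolding le_def
          using out_lt_trans[OF qm(2,1,2)] out_lt_irrefl[OF qm(2)] out_lt_out_eq[of v q m m m] out_eq_sym by auto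
    qed
    then show ?thesis using that[of m] m hi unfolding X_def by blast
  qed
qed

text \<open>Follow \<open>p0\<close> up to the first touched vertex \<open>v\<close> and leave it
  along a suitable route \<open>m\<close> of the clique. From \<open>H e\<close> up to
  \<open>v\<close> nothing is shared, at \<open>v\<close> the choice of \<open>m\<close> prevents
  conflicts, and later conflicts would be conflicts of \<open>m\<close>. If no vertex is touched,
  \<open>p0\<close> itself serves.\<close>

lemma extend_after:
  assumes D: "clique D" and p0: "p0 \<in> R" "e \<in> arcs_of p0" and unused: "\<forall>q\<in>D. e \<notin> arcs_of q"
  obtains p where "p \<in> R" "in_eq (H e) p p0" "\<forall>q\<in>D. \<forall>w \<ge> H e. \<not> conflict w p q"
proof (cases "\<exists>w \<ge> H e. through p0 w \<and> (\<exists>q\<in>D. through q w)")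
  case False
  then show ?thesis using that[of p0] p0(1) unfolding conflict_def clockwise_def by auto
next
  case True
  obtain v f where v: "v \<ge> H e" "through p0 v" "\<exists>q\<in>D. through q v"
    and f: "f \<in> arcs_of p0" "H f = v" "\<forall>q\<in>D. f \<notin> arcs_of q"
    and first: "\<forall>w. H e \<le> w \<and> w < v \<and> through p0 w \<longrightarrow> \<not> (\<exists>q\<in>D. through q w)"
    using first_touched[OF D p0 unused True] by metis
  obtain m where m: "m \<in> D" "through m v"
    and at: "\<forall>q\<in>D. through q v \<longrightarrow> \<not> (in_lt v p0 q \<and> out_lt v q m) \<and> \<not> (in_lt v q p0 \<and> out_lt v m q)"
    using coherent_suffix[OF D p0(1) f(1,2) v(2) f(3) v(3)] by metis
  have mR: "m \<in> R" using m cliqueD D by blast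
  obtain p where p: "is_splice v p0 m p" using splice[OF p0(1) mR v(2) m(2)] .
  have "\<not> conflict w p q" if q: "q \<in> D" and w: "w \<ge> H e" for q w
  proof -
    have qR: "q \<in> R" using cliqueD D q by blast
    have no: "\<not> conflict v p q" using conflict_splice_at[OF p, of q] at q by blast
    have "\<not> conflict w p0 q" if "w < v" using first w that q unfolding conflict_def clockwise_def by blast
    moreover have "\<not> conflict w m q" using cliqueD(2)[OF D m(1) q] unfolding coherent_def by blast
    ultimately show ?thesis
      using no conflict_splice_before[OF p qR, of w] conflict_splice_after[OF p qR, of w]
      by (cases w v rule: linorder_cases) auto
  qed
  moreover have "p \<in> R" "in_eq (H e) p p0" using p v in_eq_mono unfolding is_splice_def by blast+
  ultimately show ?thesis using that by blast
qed

lemma extend_before: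
  assumes D: "clique D" and p0: "p0 \<in> R" "e \<in> arcs_of p0" and unused: "\<forall>q\<in>D. e \<notin> arcs_of q"
  obtains p where "p \<in> R" "out_eq (T e) p p0" "\<forall>q\<in>D. \<forall>w \<le> T e. \<not> conflict w p q"
proof -
  interpret d: route_system R arcs_of "\<lambda>e. - H e" "\<lambda>e. - T e" In Out by (rule dual)
  obtain p where p: "p \<in> R" "d.in_eq (- T e) p p0" "\<forall>q\<in>D. \<forall>w \<ge> - T e. \<not> d.conflict w p q"
    using d.extend_after[of D p0 e] assms by (auto simp: dual_simps)
  have "\<not> conflict w p q" if "q \<in> D" "w \<le> T e" for q w
    using p(3) that by (metis dual_simps(9) neg_le_iff_le)
  then show ?thesis using that[of p] p by (simp add: dual_simps)
qed

lemma maximal_clique_uses_arc: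
  assumes D: "maximal_clique D" and e: "e \<in> \<Union>(arcs_of ` R)"
  shows "\<exists>q\<in>D. e \<in> arcs_of q"
proof (rule ccontr)
  assume "\<not> ?thesis"
  then have unused: "\<forall>q\<in>D. e \<notin> arcs_of q" by blast
  have cD: "clique D" using D unfolding maximal_clique_def by blast
  obtain p0 where p0: "p0 \<in> R" "e \<in> arcs_of p0" using e by blast
  obtain p1 where p1: "p1 \<in> R" "in_eq (H e) p1 p0" "\<forall>q\<in>D. \<forall>w \<ge> H e. \<not> conflict w p1 q"
    using extend_after[OF cD p0 unused] .
  have e1: "e \<in> arcs_of p1" using p1(2) p0 unfolding in_eq_def by blast
  obtain p where p: "p \<in> R" "out_eq (T e) p p1" "\<forall>q\<in>D. \<forall>w \<le> T e. \<not> conflict w p q"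
    using extend_before[OF cD p1(1) e1 unused] .
  have ep: "e \<in> arcs_of p" using p(2) e1 unfolding out_eq_def by blast
  have "coherent p q" if q: "q \<in> D" for q unfolding coherent_def
  proof (intro allI notI)
    fix w assume c: "conflict w p q"
    then have tp: "through p w" and tq: "through q w" unfolding conflict_def clockwise_def by auto
    \<comment> \<open>The second repair excludes conflicts up to the tail of \<open>e\<close>, and
      \<open>p\<close> has no vertex strictly inside \<open>e\<close>.\<close>
    have wH: "H e \<le> w" using c p(3) q through_less_iff[OF p(1) tp ep] by (meson not_less)
    have late: "g \<in> arcs_of p \<longleftrightarrow> g \<in> arcs_of p1" if "T e < H g" for g
    proof -
      have "T e \<le> T g" if "g \<in> arcs_of p'" "e \<in> arcs_of p'" "p' \<in> R" for p'
        using chain[OF that(3,1,2)] \<open>T e < H g\<close> arc_less[OF that(3,2)] by auto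
      then show ?thesis using p(1,2) p1(1) ep e1 unfolding out_eq_def by blast
    qed
    have Te: "T e < w" using wH arc_less[OF p(1) ep] by simp
    have t1: "through p1 w" using tp late Te p(2) unfolding through_def out_eq_def
      by (metis less_imp_le)
    have ag: "agree_in (T e) w p p1" unfolding agree_in_def using late by blast
    \<comment> \<open>Since \<open>q\<close> misses \<open>e\<close>, the incoming comparison with
      \<open>q\<close> at \<open>w\<close> is decided no further back than \<open>e\<close>. There
      \<open>p\<close> and \<open>p1\<close> agree, so a conflict of \<open>p\<close> would be one
      of \<open>p1\<close>.\<close>
    have nag: "\<not> agree_in (T e) w p q" unfolding agree_in_def using ep unused q wH arc_less[OF p(1) ep] by blast
    then have nag': "\<not> agree_in (T e) w q p" unfolding agree_in_def by blast
    have refl: "agree_in (T e) w q q" unfolding agree_in_def by blast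
    have "in_lt w p q \<longleftrightarrow> in_lt w p1 q" "in_lt w q p \<longleftrightarrow> in_lt w q p1"
      using in_lt_cong[OF ag refl nag] in_lt_cong[OF refl ag nag'] by blast+
    moreover have "out_lt w p q \<longleftrightarrow> out_lt w p1 q" "out_lt w q p \<longleftrightarrow> out_lt w q p1"
      using out_lt_out_eq out_eq_mono[OF p(2)] Te out_eq_refl by (meson less_imp_le)+
    ultimately have "conflict w p1 q" using c t1 unfolding conflict_def clockwise_def by blast
    then show False using p1(3) q wH by blast
  qed
  then have "p \<in> D" using D p unfolding maximal_clique_def by blast
  then show False using unused ep by blast
qed

section \<open>Cornering routes\<close>

definition corner :: "'e \<Rightarrow> 'e \<Rightarrow> bool" where
  "corner a b \<longleftrightarrow> (a, b) \<in> In \<and> (\<nexists>e. (a, e) \<in> In \<and> (e, b) \<in> In)"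

definition upper :: "'r set \<Rightarrow> 'e \<Rightarrow> 'r \<Rightarrow> bool" where
  "upper D b u \<longleftrightarrow> u \<in> D \<and> b \<in> arcs_of u \<and> (\<forall>q\<in>D. b \<in> arcs_of q \<longrightarrow> le (H b) u q)"

definition lower :: "'r set \<Rightarrow> 'e \<Rightarrow> 'r \<Rightarrow> bool" where
  "lower D a l \<longleftrightarrow> l \<in> D \<and> a \<in> arcs_of l \<and> (\<forall>q\<in>D. a \<in> arcs_of q \<longrightarrow> le (H a) q l)"

lemma through_In:
  assumes "p \<in> R" "(a, b) \<in> In" "e \<in> arcs_of p" "e = a \<or> e = b" shows "through p (H a)"
  using In_arcs[OF assms(2)] through_arc[OF assms(1,3)] assms(4) by auto

text \<open>Rests on \<open>maximal_clique_uses_arc\<close>: some route of \<open>D\<close> uses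
  \<open>b\<close>, and coherence makes \<open>le\<close> total on all such routes.\<close>

lemma exists_upper:
  assumes D: "maximal_clique D" and ab: "(a, b) \<in> In" shows "\<exists>u. upper D b u"
proof -
  have cD: "clique D" using D unfolding maximal_clique_def by blast
  define X where "X = {q\<in>D. b \<in> arcs_of q}"
  have "X \<noteq> {}" using maximal_clique_uses_arc[OF D, of b] In_arcs[OF ab] unfolding X_def by blast
  moreover have "X \<subseteq> R" "\<forall>p\<in>X. \<forall>q\<in>X. coherent p q" using cliqueD[OF cD] unfolding X_def by auto
  moreover have "\<forall>p\<in>X. through p (H b)"
    using through_In[OF _ ab] In_arcs[OF ab] cliqueD[OF cD] unfolding X_def by auto
  ultimately obtain m where "m \<in> X" "\<forall>q\<in>X. le (H b) m q" using least_route by metis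
  then show ?thesis unfolding upper_def X_def by blast
qed

lemma exists_lower:
  assumes D: "maximal_clique D" and ab: "(a, b) \<in> In" shows "\<exists>l. lower D a l"
proof -
  have cD: "clique D" using D unfolding maximal_clique_def by blast
  define X where "X = {q\<in>D. a \<in> arcs_of q}"
  have "X \<noteq> {}" using maximal_clique_uses_arc[OF D, of a] In_arcs[OF ab] unfolding X_def by blast
  moreover have "X \<subseteq> R" "\<forall>p\<in>X. \<forall>q\<in>X. coherent p q" using cliqueD[OF cD] unfolding X_def by auto
  moreover have "\<forall>p\<in>X. through p (H a)"
    using through_In[OF _ ab] In_arcs[OF ab] cliqueD[OF cD] unfolding X_def by auto
  ultimately obtain m where "m \<in> X" "\<forall>q\<in>X. le (H a) q m" using greatest_route by metis
  then show ?thesis unfolding lower_def X_def by blast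
qed

text \<open>
  Otherwise the splice of \<open>u\<close> with the suffix of \<open>l\<close> would be a route of \<open>D\<close> through \<open>b\<close> below \<open>u\<close>.
\<close>

lemma upper_lower_out_eq:
  assumes D: "maximal_clique D" and c: "corner a b" and u: "upper D b u" and l: "lower D a l"
  shows "out_eq (H b) u l"
proof (rule ccontr)
  assume neq: "\<not> out_eq (H b) u l"
  have cD: "clique D" using D unfolding maximal_clique_def by blast
  have ab: "(a, b) \<in> In" using c unfolding corner_def by blast
  define v where "v = H b"
  have Hv: "H a = v" "H b = v" using In_arcs[OF ab] unfolding v_def by auto
  have "a \<noteq> b" using ab In_irrefl by blast
  have uR: "u \<in> R" "b \<in> arcs_of u" "u \<in> D" and lR: "l \<in> R" "a \<in> arcs_of l" "l \<in> D"
    using u l cliqueD[OF cD] unfolding upper_def lower_def by auto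
  have ut: "through u v" and lt: "through l v" using through_In[OF _ ab] uR lR Hv by auto
  have "in_lt v l u" using in_lt_iff_arcs[OF lR(1) uR(1) lR(2) uR(2) Hv \<open>a \<noteq> b\<close>] ab by simp
  \<comment> \<open>As \<open>l\<close> enters below \<open>u\<close>, coherence leaves no other
    strict outgoing comparison.\<close>
  then have lu: "out_lt v l u"
    using out_lt_total[OF uR(1) lR(1) ut lt] coherentD[OF cliqueD(2)[OF cD lR(3) uR(3)] lt ut] neq v_def by auto
  obtain r where r: "is_splice v u l r" using splice[OF uR(1) lR(1) ut lt] .
  have rR: "r \<in> R" "in_eq v r u" "out_eq v r l" using r unfolding is_splice_def by auto
  have "coherent r t" if t: "t \<in> D" for t
  proof (rule coherent_splice[OF r])
    show tR: "t \<in> R" using t cliqueD[OF cD] by blast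
    show cut: "coherent u t" and clt: "coherent l t" using t cliqueD[OF cD] uR lR by auto
    show "\<not> conflict v r t" unfolding conflict_splice_at[OF r]
    proof (intro notI, elim conjE)
      assume tt: "through t v" and h: "in_lt v u t \<and> out_lt v t l \<or> in_lt v t u \<and> out_lt v l t"
      obtain g where g: "g \<in> arcs_of t" "H g = v" using tt unfolding through_def by blast
      have inu: "in_lt v u t \<longleftrightarrow> (b, g) \<in> In" "in_lt v t u \<longleftrightarrow> (g, b) \<in> In" if "g \<noteq> b"
        using in_lt_iff_arcs[OF uR(1) tR uR(2) g(1) Hv(2) g(2)] in_lt_iff_arcs[OF tR uR(1) g(1) uR(2) g(2) Hv(2)]
          that by auto
      have "in_lt v t l \<longleftrightarrow> (g, a) \<in> In" if "g \<noteq> a"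
        using in_lt_iff_arcs[OF tR lR(1) g(1) lR(2) g(2) Hv(1)] that by auto
      note inl = this
      \<comment> \<open>Because \<open>a\<close> and \<open>b\<close> are consecutive,
        \<open>t\<close> enters through \<open>a\<close> or \<open>b\<close>, below both or above
        both. The first two cases contradict the extremality of \<open>l\<close> and
        \<open>u\<close>, the last two the coherence of \<open>t\<close> with \<open>l\<close> and
        \<open>u\<close>.\<close>
      consider "g = a" | "g = b" | "g \<noteq> a" "g \<noteq> b" "(g, b) \<in> In" | "g \<noteq> a" "g \<noteq> b" "(b, g) \<in> In"
        using In_total[OF uR(1) tR uR(2) g(1)] g Hv ut unfolding through_def by auto
      then show False
      proof cases
        case 1
        then have "le v t l" using l t g Hv unfolding lower_def by auto
        then have "\<not> out_lt v l t" unfolding le_def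
          using out_lt_trans[OF lR(1) tR lR(1), of v] out_lt_irrefl[OF lR(1)] out_lt_out_eq[of v l l t l] by auto
        moreover have "\<not> in_lt v u t" using inu 1 \<open>a \<noteq> b\<close> ab In_trans In_irrefl by metis
        ultimately show False using h by blast
      next
        case 2
        then have le: "le v u t" using u t g Hv unfolding upper_def by auto
        then have "\<not> in_lt v t u" unfolding le_def
          using in_lt_trans[OF uR(1) tR uR(1), of v] in_lt_irrefl[OF uR(1)] in_lt_in_eq[of v u t u u] by auto
        moreover have "\<not> out_lt v t l"
        proof
          assume "out_lt v t l"
          then have "out_lt v t u" using out_lt_trans[OF tR lR(1) uR(1)] lu by blast
          then show False using le unfolding le_def
            using out_lt_trans[OF uR(1) tR uR(1), of v] out_lt_irrefl[OF uR(1)] out_lt_out_eq[of v u t u u] by auto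
        qed
        ultimately show False using h by blast
      next
        case 3
        then have "(g, a) \<in> In"
          using In_total[OF lR(1) tR lR(2) g(1)] c g Hv lt unfolding through_def corner_def by auto
        then have "\<not> out_lt v l t" using inl 3 coherentD[OF clt lt tt] by blast
        moreover have "\<not> in_lt v u t" using inu 3 In_trans In_irrefl by metis
        ultimately show False using h by blast
      next
        case 4
        then have "\<not> out_lt v t u" using inu coherentD[OF cut ut tt] by blast
        then have "\<not> out_lt v t l" using out_lt_trans[OF tR lR(1) uR(1)] lu by blast
        moreover have "\<not> in_lt v t u" using inu 4 In_trans In_irrefl by metis
        ultimately show False using h by blast
      qed
    qed
  qed
  then have "r \<in> D" using D rR unfolding maximal_clique_def by blast
  moreover have "b \<in> arcs_of r" using rR(2) uR Hv unfolding in_eq_def by simp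
  ultimately have "le v u r" using u Hv unfolding upper_def by auto
  moreover have "out_lt v r u" using out_lt_out_eq[OF rR(3), of u u] lu by simp
  ultimately show False unfolding le_def
    using out_lt_trans[OF uR(1) rR(1) uR(1), of v] out_lt_irrefl[OF uR(1)] out_lt_out_eq[of v u r u u] by auto
qed

text \<open>Both comparisons are unchanged along a shared arc, so a conflict slides from its head to
  its tail. Consequently two routes enter their first vertex of conflict through different
  arcs.\<close>

lemma conflict_back:
  assumes pq: "p \<in> R" "q \<in> R" and c: "conflict x p q" and g: "g \<in> arcs_of p" "g \<in> arcs_of q" "H g = x"
  shows "conflict (T g) p q"
proof -
  define y where "y = T g"
  have yx: "y < x" using arc_less[OF pq(1) g(1)] g y_def by simp
  have "h = g" if "h \<in> arcs_of p'" "g \<in> arcs_of p'" "p' \<in> R" "H h \<le> x" "y < H h" for h p'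
    using chain[OF that(3,1,2)] arc_less[OF that(3,1)] that g(3) y_def by auto
  then have ain: "agree_in y x p q" "agree_in y x q p" unfolding agree_in_def using pq g by blast+
  have px: "through p x" "through q x" using c unfolding conflict_def clockwise_def by auto
  have inlt: "in_lt y p q \<longleftrightarrow> in_lt x p q" "in_lt y q p \<longleftrightarrow> in_lt x q p"
    using in_lt_step[of p q y x] in_lt_step[of q p y x] ain pq yx by auto
  have "in_lt y p q \<or> in_lt y q p" using inlt c unfolding conflict_def clockwise_def by blast
  \<comment> \<open>The strict incoming comparison exhibits arcs ending at or before
    \<open>y\<close>, so neither route starts at \<open>y\<close> and both pass through it.\<close>
  then obtain e f where ef: "e \<in> arcs_of p" "f \<in> arcs_of q" "H e \<le> y" "H f \<le> y" unfolding in_lt_def by auto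
  have py: "through p y" "through q y"
    using link_in[OF pq(1) ef(1) g(1)] link_in[OF pq(2) ef(2) g(2)] ef g unfolding through_def y_def by auto
  have "agree y x p q" "agree y x q p" using agree_in_iff pq px py ain by blast+
  then have "out_lt y p q \<longleftrightarrow> out_lt x p q" "out_lt y q p \<longleftrightarrow> out_lt x q p"
    using out_lt_step[of p q y x] out_lt_step[of q p y x] pq yx by auto
  then show ?thesis using inlt c py unfolding y_def conflict_def clockwise_def by blast
qed

section \<open>Adjacent maximal cliques\<close>

context
  fixes D D' r r'
  assumes D: "maximal_clique D" and D': "maximal_clique D'"
    and diff: "D - D' = {r}" "D' - D = {r'}"
begin

lemma cliques: "clique D" "clique D'"
  using D D' unfolding maximal_clique_def by auto

lemma mem: "r \<in> D" "r \<notin> D'" "r' \<in> D'" "r' \<notin> D" "r \<in> R" "r' \<in> R"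
  using diff cliqueD cliques by blast+

lemma exchange: "t \<in> D \<Longrightarrow> t \<noteq> r \<Longrightarrow> t \<in> D'" "t \<in> D' \<Longrightarrow> t \<noteq> r' \<Longrightarrow> t \<in> D"
  using diff by blast+

text \<open>Stated for conflicts of either orientation, because a conflict other than the given one
  might a priori be oriented the other way.\<close>

lemma first_conflict:
  assumes "conflict v r r'"
  obtains x where "conflict x r r'" "\<And>w. conflict w r r' \<Longrightarrow> x \<le> w \<and> agree x w r r'"
proof -
  define C where "C = {w. conflict w r r'}"
  have "\<exists>e\<in>arcs_of r. H e = w" if "conflict w r r'" for w
    using that unfolding conflict_def clockwise_def through_def by blast
  then have "C \<subseteq> H ` arcs_of r" unfolding C_def by blast
  then have fin: "finite C" using finite_arcs[OF mem(5)] finite_surj by blast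
  have ne: "C \<noteq> {}" using assms unfolding C_def by auto
  define x where "x = Min C"
  have cx: "conflict x r r'" using Min_in[OF fin ne] by (simp add: x_def C_def)
  have min: "x \<le> w" if "conflict w r r'" for w using Min_le[OF fin, of w] that by (simp add: x_def C_def)
  have rx: "through r x" "through r' x" using cx unfolding conflict_def clockwise_def by auto
  obtain p where p: "is_splice x r r' p" using splice[OF mem(5,6) rx] .
  have pR: "p \<in> R" "in_eq x p r" "out_eq x p r'" using p unfolding is_splice_def by auto
  have "coherent p t" if t: "t \<in> D'" for t
  proof (cases "t = r'")
    case True
    \<comment> \<open>The splice leaves \<open>x\<close> exactly like \<open>r'\<close>, so no
      strict outgoing comparison is left; a conflict before \<open>x\<close> would come from
      \<open>r\<close> and contradict minimality.\<close>
    have "\<not> conflict x p r'" unfolding conflict_splice_at[OF p] using out_lt_irrefl mem by blast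
    moreover have "\<not> conflict w r r'" if "w < x" for w using min[of w] that by auto
    moreover have "\<not> conflict w r' r'" for w using coherent_refl mem unfolding coherent_def by blast
    ultimately have "\<not> conflict w p r'" for w
      using conflict_splice_before[OF p mem(6), of w] conflict_splice_after[OF p mem(6), of w]
      by (cases w x rule: linorder_cases) auto
    then show ?thesis using True unfolding coherent_def by blast
  next
    case False
    then have tD: "t \<in> D" using exchange t by blast
    have tR: "t \<in> R" using tD cliqueD cliques by blast
    have ct: "coherent r t" "coherent r' t" using cliqueD cliques tD t mem by auto
    \<comment> \<open>Such a conflict compares the entry of \<open>t\<close> with \<open>r\<close>
      and its exit with \<open>r'\<close>. Transitivity with the conflict of \<open>r\<close> and
      \<open>r'\<close> turns it into a conflict of \<open>t\<close> with one of these two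
      routes.\<close>
    have "\<not> conflict x p t" unfolding conflict_splice_at[OF p]
    proof (intro notI, elim conjE)
      assume tx: "through t x" and h: "in_lt x r t \<and> out_lt x t r' \<or> in_lt x t r \<and> out_lt x r' t"
      note n = coherentD[OF ct(1) rx(1) tx] coherentD[OF ct(2) rx(2) tx]
      have "in_lt x r r' \<and> out_lt x r' r \<or> in_lt x r' r \<and> out_lt x r r'"
        using cx unfolding conflict_def clockwise_def by blast
      then show False using h n
          out_lt_trans[OF tR mem(6,5), of x] out_lt_trans[OF mem(5,6) tR, of x]
          in_lt_trans[OF tR mem(5,6), of x] in_lt_trans[OF mem(6,5) tR, of x] by blast
    qed
    then show ?thesis using coherent_splice[OF p tR ct] by blast
  qed
  then have pD': "p \<in> D'" using D' pR unfolding maximal_clique_def by blast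
  \<comment> \<open>The splice enters \<open>x\<close> like \<open>r\<close>, whereas
    \<open>r\<close> and \<open>r'\<close> compare strictly there.\<close>
  have "p \<noteq> r'"
  proof
    assume "p = r'"
    then have "in_lt x r r' \<longleftrightarrow> in_lt x r r" "in_lt x r' r \<longleftrightarrow> in_lt x r r"
      using in_lt_in_eq[OF pR(2), of r r] in_lt_in_eq[OF in_eq_refl pR(2), of r] by auto
    then show False using in_lt_irrefl[OF mem(5)] cx unfolding conflict_def clockwise_def by blast
  qed
  then have "p \<in> D" using exchange pD' by blast
  then have cpr: "coherent p r" using cliqueD cliques mem by blast
  \<comment> \<open>If \<open>r\<close> and \<open>r'\<close> differed between \<open>x\<close> and
    \<open>w\<close>, the incoming comparison at \<open>w\<close> would be decided on that stretch,
    where the splice follows \<open>r'\<close>. The conflict at \<open>w\<close> would then be one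
    of the splice with \<open>r\<close>, both in \<open>D\<close>.\<close>
  have "agree x w r r'" if cw: "conflict w r r'" for w
  proof (rule ccontr)
    assume nag: "\<not> agree x w r r'"
    have xw: "x < w"
    proof (rule ccontr)
      assume "\<not> x < w"
      then have "agree x w r r'" using min[OF cw] unfolding agree_def by auto
      then show False using nag by blast
    qed
    have rw: "through r w" "through r' w" using cw unfolding conflict_def clockwise_def by auto
    have px: "through p x" using is_splice_through[OF p] .
    have pw: "through p w"
      using through_after[OF pR(1) mem(6) px rx(2) out_eq_sym[OF pR(3)] xw rw(2)] .
    have "agree x w p r'" using pR(3) unfolding out_eq_def agree_def by blast
    then have ag: "agree_in x w r' p" using agree_in_iff px pw rx rw pR mem agree_sym by blast
    have nag1: "\<not> agree_in x w r' r" using nag agree_in_iff rx rw mem agree_sym by blast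
    then have nag2: "\<not> agree_in x w r r'" unfolding agree_in_def by blast
    have rr: "agree_in x w r r" unfolding agree_in_def by blast
    have "in_lt w r' r \<longleftrightarrow> in_lt w p r" "in_lt w r r' \<longleftrightarrow> in_lt w r p"
      using in_lt_cong[OF ag rr nag1] in_lt_cong[OF rr ag nag2] by blast+
    moreover have "out_eq w p r'" using out_eq_mono[OF pR(3)] xw by auto
    then have "out_lt w p r \<longleftrightarrow> out_lt w r' r" "out_lt w r p \<longleftrightarrow> out_lt w r r'"
      using out_lt_out_eq out_eq_refl by blast+
    ultimately have "conflict w p r" using cw pw rw unfolding conflict_def clockwise_def by blast
    then show False using cpr unfolding coherent_def by blast
  qed
  then show ?thesis using that cx min by blast
qed

text \<open>Cornering routes different from the exchanged ones lie in both cliques, so each is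
  extremal against the other and antisymmetry applies; likewise for lower routes below.\<close>

lemma upper_eq: "upper D b u \<Longrightarrow> upper D' b u' \<Longrightarrow> through u (H b) \<Longrightarrow> through u' (H b)
    \<Longrightarrow> u \<noteq> r \<Longrightarrow> u' \<noteq> r' \<Longrightarrow> u = u'"
  unfolding upper_def using exchange[of u] exchange(2)[of u']
    le_antisym[of u u' "H b"] cliqueD(1)[OF cliques(1)] by blast

lemma lower_eq: "lower D a l \<Longrightarrow> lower D' a l' \<Longrightarrow> through l (H a) \<Longrightarrow> through l' (H a)
    \<Longrightarrow> l \<noteq> r \<Longrightarrow> l' \<noteq> r' \<Longrightarrow> l = l'"
  unfolding lower_def using exchange[of l] exchange(2)[of l']
    le_antisym[of l l' "H a"] cliqueD(1)[OF cliques(1)] by blast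

lemma changed_corner:
  assumes cw: "clockwise v r r'"
  obtains a b where "corner a b" "lower D a r" "upper D' b r'" "out_lt (H b) r' r"
    "\<And>a' b' u u'. corner a' b' \<Longrightarrow> (a', b') \<noteq> (a, b) \<Longrightarrow> upper D b' u \<Longrightarrow> upper D' b' u'
      \<Longrightarrow> out_eq (H b') u u'"
proof -
  have cv: "conflict v r r'" using cw unfolding conflict_def by blast
  obtain x where cx: "conflict x r r'" and all: "\<And>w. conflict w r r' \<Longrightarrow> x \<le> w \<and> agree x w r r'"
    using first_conflict[OF cv] by blast
  have rx: "through r x" "through r' x" using cx unfolding conflict_def clockwise_def by auto
  have xv: "x \<le> v" "agree x v r r'" using all[OF cv] by auto
  \<comment> \<open>The common part from \<open>x\<close> to \<open>v\<close> carries the outgoing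
    comparison back to \<open>x\<close>. As \<open>x\<close> is a vertex of conflict, the incoming
    comparison there must have the matching direction.\<close>
  then have cwx: "out_lt x r' r" using cw out_lt_step[OF mem(6,5)] agree_sym unfolding clockwise_def by blast
  then have inx: "in_lt x r r'" using cx out_lt_trans[OF mem(6,5,6), of x] out_lt_irrefl[OF mem(6), of x]
    unfolding conflict_def clockwise_def by blast
  obtain a b where a: "a \<in> arcs_of r" "H a = x" and b: "b \<in> arcs_of r'" "H b = x"
    using rx unfolding through_def by blast
  \<comment> \<open>A shared entering arc would carry the conflict to an earlier vertex.\<close>
  have ne: "a \<noteq> b"
  proof
    assume "a = b"
    then have "conflict (T a) r r'" using conflict_back[OF mem(5,6) cx a(1)] a b by auto
    then show False using all[of "T a"] arc_less[OF mem(5) a(1)] a by auto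
  qed
  have ab: "(a, b) \<in> In" using in_lt_iff_arcs[OF mem(5,6) a(1) b(1) a(2) b(2) ne] inx by blast
  have out_r: "\<not> out_lt x t r \<or> \<not> in_lt x r t" "\<not> out_lt x r t \<or> \<not> in_lt x t r"
    if "t \<in> D" "through t x" for t
    using coherentD[OF cliqueD(2)[OF cliques(1) mem(1) that(1)] rx(1) that(2)] by auto
  have out_r': "\<not> out_lt x t r' \<or> \<not> in_lt x r' t" "\<not> out_lt x r' t \<or> \<not> in_lt x t r'"
    if "t \<in> D'" "through t x" for t
    using coherentD[OF cliqueD(2)[OF cliques(2) mem(3) that(1)] rx(2) that(2)] by auto
  have corner: "corner a b" unfolding corner_def
  proof (intro conjI notI ab, elim exE conjE)
    fix e assume e: "(a, e) \<in> In" "(e, b) \<in> In"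
    then have He: "H e = x" using In_arcs[OF e(1)] a by simp
    obtain t where t: "t \<in> D" "e \<in> arcs_of t" using maximal_clique_uses_arc[OF D, of e] In_arcs[OF e(1)] by blast
    have ea: "a \<noteq> e" "e \<noteq> b" using e In_irrefl by auto
    have tR: "t \<in> R" using t cliqueD cliques by blast
    have "t \<noteq> r" using unique_head[OF mem(5) a(1), of e] ea a He t by auto
    then have t': "t \<in> D'" using exchange t by blast
    have tx: "through t x" using through_In[OF tR e(1) t(2)] a by auto
    have "in_lt x r t" "in_lt x t r'"
      using in_lt_iff_arcs[OF mem(5) tR a(1) t(2) a(2) He ea(1)] e
        in_lt_iff_arcs[OF tR mem(6) t(2) b(1) He b(2) ea(2)] by auto
    \<comment> \<open>So \<open>t\<close> leaves weakly above \<open>r\<close> and weakly below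
      \<open>r'\<close>, although \<open>r'\<close> leaves strictly below \<open>r\<close>.\<close>
    then have "\<not> out_lt x t r" "\<not> out_lt x r' t" using out_r out_r' t t' tx by blast+
    then have "out_lt x r t \<or> out_eq x r t" "out_lt x t r' \<or> out_eq x t r'"
      using out_lt_total[OF mem(5) tR rx(1) tx] out_lt_total[OF tR mem(6) tx rx(2)] by auto
    then have "out_lt x r r' \<or> out_eq x r r'"
      using out_lt_trans[OF mem(5) tR mem(6), of x] out_lt_out_eq[of x r r t r'] out_lt_out_eq[of x r t r' r']
        out_eq_trans[of x r t r'] by auto
    then show False using cwx out_lt_trans[OF mem(6,5,6), of x] out_lt_irrefl[OF mem(6), of x]
        out_lt_out_eq[of x r' r' r r'] by auto
  qed
  have low: "lower D a r" unfolding lower_def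
  proof (intro conjI ballI impI mem a(1))
    fix t assume t: "t \<in> D" "a \<in> arcs_of t"
    have tR: "t \<in> R" using t cliqueD cliques by blast
    have tx: "through t x" using through_In[OF tR ab t(2)] a by auto
    show "le (H a) t r"
    proof (cases "t = r")
      case False
      then have t': "t \<in> D'" using exchange t by blast
      have "in_lt x t r'" using in_lt_iff_arcs[OF tR mem(6) t(2) b(1) a(2) b(2) ne] ab by auto
      then have "\<not> out_lt x r' t" using out_r' t' tx by blast
      \<comment> \<open>The route \<open>t\<close> leaves weakly below \<open>r'\<close>, hence
        strictly below \<open>r\<close>, and coherence with \<open>r\<close> then settles the
        incoming comparison.\<close>
      then have o: "out_lt x t r"
        using out_lt_total[OF tR mem(6) tx rx(2)] cwx out_lt_trans[OF tR mem(6,5), of x]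
          out_lt_out_eq[of x t r' r r] by auto
      then have "\<not> in_lt x r t" using out_r t tx by blast
      then have "in_lt x t r \<or> in_eq x t r" using in_lt_total[OF tR mem(5) tx rx(1)] by blast
      then show ?thesis using o a unfolding le_def by simp
    qed (simp add: le_refl)
  qed
  have up: "upper D' b r'" unfolding upper_def
  proof (intro conjI ballI impI mem b(1))
    fix t assume t: "t \<in> D'" "b \<in> arcs_of t"
    have tR: "t \<in> R" using t cliqueD cliques by blast
    have tx: "through t x" using through_In[OF tR ab t(2)] a by auto
    show "le (H b) r' t"
    proof (cases "t = r'")
      case False
      then have t': "t \<in> D" using exchange t by blast
      have "in_lt x r t" using in_lt_iff_arcs[OF mem(5) tR a(1) t(2) a(2) b(2) ne] ab by auto
      then have "\<not> out_lt x t r" using out_r t' tx by blast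
      then have o: "out_lt x r' t"
        using out_lt_total[OF mem(5) tR rx(1) tx] cwx out_lt_trans[OF mem(6,5) tR, of x]
          out_lt_out_eq[of x r' r' r t] by auto
      then have "\<not> in_lt x t r'" using out_r' t tx by blast
      then have "in_lt x r' t \<or> in_eq x r' t" using in_lt_total[OF mem(6) tR rx(2) tx] by blast
      then show ?thesis using o b unfolding le_def by simp
    qed (simp add: le_refl)
  qed
  \<comment> \<open>At a conflict beyond \<open>x\<close> both routes arrive along their common
    subpath and share the entering arc. Different entering arcs therefore single out
    \<open>x\<close>.\<close>
  have at_x: "w = x"
    if c: "conflict w r r'" and e: "e \<in> arcs_of r" "H e = w" and f: "f \<in> arcs_of r'" "H f = w" and ef: "e \<noteq> f" for w e f
  proof (rule ccontr)
    assume "w \<noteq> x"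
    then have "x < w" "agree x w r r'" using all[OF c] by auto
    moreover have "x \<le> T e" using through_less_iff[OF mem(5) rx(1) e(1)] e \<open>x < w\<close> by auto
    moreover have "T e < w" using arc_less[OF mem(5) e(1)] e by simp
    ultimately have "e \<in> arcs_of r'" using e unfolding agree_def by blast
    then show False using unique_head[OF mem(6), of e f] e f ef by auto
  qed
  have "out_eq (H b') u u'"
    if c': "corner a' b'" "(a', b') \<noteq> (a, b)" and u: "upper D b' u" and u': "upper D' b' u'" for a' b' u u'
  proof (rule ccontr)
    assume neq: "\<not> out_eq (H b') u u'"
    have ab': "(a', b') \<in> In" using c' unfolding corner_def by blast
    define w where "w = H b'"
    have Hw: "H a' = w" "H b' = w" using In_arcs[OF ab'] unfolding w_def by auto
    have ne': "a' \<noteq> b'" using ab' In_irrefl by blast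
    obtain l l' where l: "lower D a' l" and l': "lower D' a' l'" using exists_lower ab' D D' by blast
    have e: "out_eq w u l" "out_eq w u' l'"
      using upper_lower_out_eq D D' c' u u' l l' unfolding w_def by auto
    have neq2: "\<not> out_eq w u u'" "\<not> out_eq w l l'" "\<not> out_eq w u l'"
      using neq e out_eq_trans out_eq_sym unfolding w_def by blast+
    have uu: "u \<in> D" "b' \<in> arcs_of u" "u \<in> R" "u' \<in> D'" "b' \<in> arcs_of u'" "u' \<in> R"
      using u u' cliqueD cliques unfolding upper_def by auto
    have ll: "l \<in> D" "a' \<in> arcs_of l" "l \<in> R" "l' \<in> D'" "a' \<in> arcs_of l'" "l' \<in> R"
      using l l' cliqueD cliques unfolding lower_def by auto
    have thr: "through u w" "through u' w" "through l w" "through l' w"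
      using through_In[OF _ ab'] uu ll Hw by blast+
    have "u \<noteq> l" "u' \<noteq> l'" using unique_head[of u a' b'] unique_head[of u' a' b'] uu ll ne' Hw by auto
    have 1: "u = r \<or> u' = r'" using upper_eq[OF u u'] thr neq2(1) unfolding Hw by (metis out_eq_refl)
    have 2: "l = r \<or> l' = r'" using lower_eq[OF l l'] thr neq2(2) unfolding Hw by (metis out_eq_refl)
    \<comment> \<open>No route enters \<open>w\<close> through both arcs of the corner, so
      \<open>r\<close> and \<open>r'\<close> are cornering routes on opposite sides of it.\<close>
    consider "l = r" "u' = r'" | "u = r" "l' = r'" using 1 2 \<open>u \<noteq> l\<close> \<open>u' \<noteq> l'\<close> by blast
    then show False
    proof cases
      case 1
      \<comment> \<open>The old upper route survives, so \<open>r'\<close> as the new one lies below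
        it. After \<open>w\<close> the old upper route coincides with \<open>l\<close>, which is
        \<open>r\<close>; hence \<open>r'\<close> leaves below \<open>r\<close> while entering above
        it.\<close>
      then have "u \<in> D'" using exchange(1)[OF uu(1)] \<open>u \<noteq> l\<close> by simp
      then have "le w u' u" using u' uu(2) Hw(2) unfolding upper_def by blast
      moreover have "\<not> out_eq w u' u" using neq2(1) out_eq_sym by blast
      ultimately have "out_lt w u' u" unfolding le_def by blast
      then have "out_lt w u' l" using out_lt_out_eq[OF out_eq_refl e(1)] by blast
      then have "out_lt w r' r" using 1 by simp
      moreover have "in_lt w r r'"
        using in_lt_iff_arcs[OF ll(3) uu(6) ll(2) uu(5) Hw ne'] ab' 1 by auto
      ultimately have c: "conflict w r r'" using thr unfolding 1 conflict_def clockwise_def by blast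
      have ra: "a' \<in> arcs_of r" "b' \<in> arcs_of r'" using 1 ll uu by auto
      have "w = x" using at_x[OF c ra(1) Hw(1) ra(2) Hw(2) ne'] .
      then have "a' = a" "b' = b"
        using unique_head[OF mem(5) ra(1) a(1)] unique_head[OF mem(6) ra(2) b(1)] Hw a b by auto
      then show False using c' by simp
    next
      case 2
      then have "u' \<in> D" using exchange(2)[OF uu(4)] \<open>u' \<noteq> l'\<close> by simp
      then have "le w u u'" using u uu(5) Hw(2) unfolding upper_def by blast
      then have "out_lt w u u'" using neq2(1) unfolding le_def by blast
      then have "out_lt w u l'" using out_lt_out_eq[OF out_eq_refl e(2)] by blast
      then have "out_lt w r r'" using 2 by simp
      moreover have "in_lt w r' r"
        using in_lt_iff_arcs[OF ll(6) uu(3) ll(5) uu(2) Hw ne'] ab' 2 by auto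
      ultimately have c: "conflict w r r'" using thr unfolding 2 conflict_def clockwise_def by blast
      have ra: "b' \<in> arcs_of r" "a' \<in> arcs_of r'" using 2 ll uu by auto
      have "w = x" using at_x[OF c ra(1) Hw(2) ra(2) Hw(1)] ne' by blast
      \<comment> \<open>The conflict has the opposite orientation here, so the corner would be
        \<open>(a, b)\<close> with its arcs exchanged, against the order of \<open>a\<close> and
        \<open>b\<close>.\<close>
      then have "b' = a" "a' = b"
        using unique_head[OF mem(5) ra(1) a(1)] unique_head[OF mem(6) ra(2) b(1)] Hw a b by auto
      then show False using ab ab' In_trans In_irrefl by blast
    qed
  qed
  then show ?thesis using that[OF corner low up] cwx b by blast
qed

end

end

section \<open>Routes of a framed graph\<close>

text \<open>Lets arc sets stand for arc lists. The key is integral so that it can be a tail or, for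
  prefixes read backwards, a negated head.\<close>

lemma sorted_wrt_key_unique:
  fixes k :: "'a \<Rightarrow> int"
  assumes "sorted_wrt (\<lambda>e f. k e < k f) xs" "sorted_wrt (\<lambda>e f. k e < k f) ys" "set xs = set ys"
  shows "xs = ys"
proof (rule map_sorted_distinct_set_unique)
  have *: "sorted_wrt (<) (map k xs)" "sorted_wrt (<) (map k ys)"
    using assms by (simp_all add: sorted_wrt_map)
  then show "sorted (map k xs)" "distinct (map k xs)" "sorted (map k ys)" "distinct (map k ys)"
    by (simp_all add: strict_sorted_iff)
  then show "inj_on k (set xs \<union> set ys)" using assms(3) by (simp add: distinct_map)
qed fact

text \<open>The bridge from \<open>lexord\<close> on arc lists to first differences of arc sets;
  \<open>no_prefix\<close> removes the case in which \<open>lexord\<close> holds because the first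
  list is a proper prefix.\<close>

lemma lexord_iff_first_difference:
  fixes k :: "'a \<Rightarrow> int"
  assumes xs: "sorted_wrt (\<lambda>e f. k e < k f) xs" and ys: "sorted_wrt (\<lambda>e f. k e < k f) ys"
    and key: "\<And>e f. (e, f) \<in> r \<Longrightarrow> k e = k f" and no_prefix: "\<And>a v. ys \<noteq> xs @ a # v"
  shows "(xs, ys) \<in> lexord r \<longleftrightarrow> (\<exists>e\<in>set xs. \<exists>f\<in>set ys. k e = k f \<and> (e, f) \<in> r \<and>
    (\<forall>g. k g < k e \<longrightarrow> (g \<in> set xs \<longleftrightarrow> g \<in> set ys)))"
proof
  assume "(xs, ys) \<in> lexord r"
  then obtain u e f v w where d: "(e, f) \<in> r" "xs = u @ e # v" "ys = u @ f # w"
    unfolding lexord_def using no_prefix by blast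
  have "g \<in> set u" if "g \<in> set xs" "k g < k e" for g using xs that d by (auto simp: sorted_wrt_append)
  moreover have "g \<in> set u" if "g \<in> set ys" "k g < k f" for g using ys that d by (auto simp: sorted_wrt_append)
  ultimately have "\<forall>g. k g < k e \<longrightarrow> (g \<in> set xs \<longleftrightarrow> g \<in> set ys)" using d key[OF d(1)] by auto
  then show "\<exists>e\<in>set xs. \<exists>f\<in>set ys. k e = k f \<and> (e, f) \<in> r \<and>
    (\<forall>g. k g < k e \<longrightarrow> (g \<in> set xs \<longleftrightarrow> g \<in> set ys))"
    using d key[OF d(1)] by (intro bexI[of _ e] bexI[of _ f]) auto
next
  assume "\<exists>e\<in>set xs. \<exists>f\<in>set ys. k e = k f \<and> (e, f) \<in> r \<and>
    (\<forall>g. k g < k e \<longrightarrow> (g \<in> set xs \<longleftrightarrow> g \<in> set ys))"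
  then obtain e f where ef: "e \<in> set xs" "f \<in> set ys" "k e = k f" "(e, f) \<in> r"
    "\<forall>g. k g < k e \<longrightarrow> (g \<in> set xs \<longleftrightarrow> g \<in> set ys)" by blast
  obtain u v where x: "xs = u @ e # v" using ef(1) by (meson split_list)
  obtain u' w where y: "ys = u' @ f # w" using ef(2) by (meson split_list)
  \<comment> \<open>Sortedness makes \<open>u\<close> exactly the part of \<open>xs\<close> with
    smaller key, so the initial segments have equal sets and are equal as lists.\<close>
  have "g \<in> set u \<longleftrightarrow> g \<in> set xs \<and> k g < k e" for g using xs x by (fastforce simp: sorted_wrt_append)
  moreover have "g \<in> set u' \<longleftrightarrow> g \<in> set ys \<and> k g < k f" for g using ys y by (fastforce simp: sorted_wrt_append)
  ultimately have "set u = set u'" using ef(3,5) by auto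
  then have "u = u'" using sorted_wrt_key_unique[of k u u'] xs ys x y by (simp add: sorted_wrt_append)
  then show "(xs, ys) \<in> lexord r" unfolding lexord_def using x y ef(4) by blast
qed

text \<open>Moves the cut at \<open>c\<close> from the arc sets into the comparison, to match
  \<open>out_lt\<close> and, with negated heads as keys, \<open>in_lt\<close>.\<close>

lemma restricted_first_difference:
  fixes k :: "'a \<Rightarrow> int"
  shows "(\<exists>e\<in>{g\<in>P. c \<le> k g}. \<exists>f\<in>{g\<in>Q. c \<le> k g}. k e = k f \<and> (e, f) \<in> r \<and>
      (\<forall>g. k g < k e \<longrightarrow> (g \<in> {g\<in>P. c \<le> k g} \<longleftrightarrow> g \<in> {g\<in>Q. c \<le> k g}))) \<longleftrightarrow>
    (\<exists>e\<in>P. \<exists>f\<in>Q. k e = k f \<and> c \<le> k e \<and> (e, f) \<in> r \<and>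
      (\<forall>g. c \<le> k g \<and> k g < k e \<longrightarrow> (g \<in> P \<longleftrightarrow> g \<in> Q)))" (is "?L \<longleftrightarrow> ?R")
proof
  assume ?L
  then obtain e f where "e \<in> P" "f \<in> Q" "c \<le> k e" "k e = k f" "(e, f) \<in> r"
    "\<forall>g. k g < k e \<longrightarrow> (g \<in> {g\<in>P. c \<le> k g} \<longleftrightarrow> g \<in> {g\<in>Q. c \<le> k g})" by blast
  then show ?R by - (rule bexI[of _ e], rule bexI[of _ f], auto)
next
  assume ?R
  then obtain e f where "e \<in> P" "f \<in> Q" "c \<le> k e" "k e = k f" "(e, f) \<in> r"
    "\<forall>g. c \<le> k g \<and> k g < k e \<longrightarrow> (g \<in> P \<longleftrightarrow> g \<in> Q)" by blast
  then show ?L by - (rule bexI[of _ e], rule bexI[of _ f], auto)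
qed

section \<open>Directed paths and routes with arcs\<close>

context flow_graph
begin

lemma cas_sorted:
  assumes "set p \<subseteq> arcs G" "cas u p w"
  shows "sorted_wrt (\<lambda>e f. head G e \<le> tail G f) p \<and> (\<forall>e\<in>set p. u \<le> tail G e \<and> head G e \<le> w) \<and> u \<le> w"
  using assms
proof (induction p arbitrary: u)
  case (Cons e es)
  then have IH: "sorted_wrt (\<lambda>e f. head G e \<le> tail G f) es" "\<forall>f\<in>set es. head G e \<le> tail G f \<and> head G f \<le> w"
    "head G e \<le> w" by auto
  have "tail G e < head G e" "tail G e = u" using Cons.prems tail_less_head by auto
  then show ?case using IH by auto
qed simp

lemma cas_split:
  assumes "cas u (xs @ e # ys) w"
  shows "cas u xs (tail G e)" "cas (head G e) ys w"
  using assms by auto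

lemma cas_append: "cas u xs v \<Longrightarrow> cas v ys w \<Longrightarrow> cas u (xs @ ys) w"
  by (induction xs arbitrary: u) auto

lemma cas_ends_arcs:
  assumes "cas u xs v" "xs \<noteq> []" shows "tail G (hd xs) = u" "head G (last xs) = v"
  using assms by (induction xs arbitrary: u) auto

lemma not_source: "e \<in> arcs G \<Longrightarrow> \<not> source (head G e)"
  unfolding source_def by auto

lemma not_sink: "e \<in> arcs G \<Longrightarrow> \<not> sink (tail G e)"
  unfolding sink_def by auto

lemma internalI: "e \<in> arcs G \<Longrightarrow> f \<in> arcs G \<Longrightarrow> head G e = v \<Longrightarrow> tail G f = v \<Longrightarrow> internal v"
  unfolding internal_def using not_source[of e] not_sink[of f] by auto

lemma internalD:
  assumes "internal v" shows "\<exists>e\<in>arcs G. head G e = v" "\<exists>e\<in>arcs G. tail G e = v"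
  using assms unfolding internal_def source_def sink_def by auto

lemma cas_to_sink: "v \<in> verts G \<Longrightarrow> \<exists>p w. set p \<subseteq> arcs G \<and> cas v p w \<and> sink w"
proof (induction "n - v" arbitrary: v rule: less_induct)
  case less
  show ?case
  proof (cases "sink v")
    case True then show ?thesis by (intro exI[of _ "[]"] exI[of _ v]) simp
  next
    case False
    then obtain e where e: "e \<in> arcs G" "tail G e = v" using less.prems unfolding sink_def out_arcs_def by blast
    have hv: "head G e \<in> verts G" using e by auto
    then have "n - head G e < n - v" using tail_less_head[OF e(1)] e(2) unfolding verts_eq by auto
    then obtain p w where "set p \<subseteq> arcs G" "cas (head G e) p w" "sink w" using less(1) hv by blast
    then show ?thesis using e by (intro exI[of _ "e # p"] exI[of _ w]) simp
  qed
qed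

lemma cas_from_source: "v \<in> verts G \<Longrightarrow> \<exists>p u. set p \<subseteq> arcs G \<and> cas u p v \<and> source u"
proof (induction v rule: less_induct)
  case (less v)
  show ?case
  proof (cases "source v")
    case True then show ?thesis by (intro exI[of _ "[]"] exI[of _ v]) simp
  next
    case False
    then obtain e where e: "e \<in> arcs G" "head G e = v" using less.prems unfolding source_def in_arcs_def by blast
    then obtain p u where "set p \<subseteq> arcs G" "cas u p (tail G e)" "source u"
      using less(1)[of "tail G e"] tail_less_head[OF e(1)] by auto
    then show ?thesis using e cas_append[of u p "tail G e" "[e]" v]
      by (intro exI[of _ "p @ [e]"] exI[of _ u]) (simp del: cas_append_iff)
  qed
qed

text \<open>Routes without arcs sit at isolated vertices and are coherent with every route.\<close>

definition proper_routes :: "(nat \<times> 'e list) set" where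
  "proper_routes = {p. route p \<and> snd p \<noteq> []}"

lemma proper_routes_iff:
  "p \<in> proper_routes \<longleftrightarrow> set (snd p) \<subseteq> arcs G \<and> snd p \<noteq> [] \<and>
    (\<exists>w. cas (fst p) (snd p) w \<and> source (fst p) \<and> sink w)"
  unfolding proper_routes_def route_def awalk_def source_def by auto

lemma proper_route_sorted:
  assumes "p \<in> proper_routes" shows "sorted_wrt (\<lambda>e f. head G e \<le> tail G f) (snd p)"
  using assms cas_sorted unfolding proper_routes_iff by blast

lemma proper_route_arcs: "p \<in> proper_routes \<Longrightarrow> e \<in> set (snd p) \<Longrightarrow> e \<in> arcs G"
  unfolding proper_routes_iff by blast

lemma proper_route_next:
  assumes p: "p \<in> proper_routes" and e: "e \<in> set (snd p)" and ns: "\<not> sink (head G e)"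
  shows "\<exists>g\<in>set (snd p). tail G g = head G e"
proof -
  obtain xs ys where s: "snd p = xs @ e # ys" using e by (meson split_list)
  obtain w where w: "cas (head G e) ys w" "sink w"
    using p cas_split unfolding proper_routes_iff s by blast
  then have "ys \<noteq> []" using ns by auto
  then have "tail G (hd ys) = head G e" using cas_ends_arcs w by blast
  moreover have "hd ys \<in> set (snd p)" using s \<open>ys \<noteq> []\<close> by simp
  ultimately show ?thesis by blast
qed

lemma proper_route_previous:
  assumes p: "p \<in> proper_routes" and e: "e \<in> set (snd p)" and ns: "\<not> source (tail G e)"
  shows "\<exists>g\<in>set (snd p). head G g = tail G e"
proof -
  obtain xs ys where s: "snd p = xs @ e # ys" using e by (meson split_list)
  have w: "cas (fst p) xs (tail G e)" "source (fst p)"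
    using p cas_split unfolding proper_routes_iff s by blast+
  then have "xs \<noteq> []" using ns by auto
  then have "head G (last xs) = tail G e" using cas_ends_arcs w by blast
  moreover have "last xs \<in> set (snd p)" using s \<open>xs \<noteq> []\<close> by simp
  ultimately show ?thesis by blast
qed

lemma proper_route_chain:
  assumes p: "p \<in> proper_routes" and "e \<in> set (snd p)" "f \<in> set (snd p)"
  shows "e = f \<or> head G e \<le> tail G f \<or> head G f \<le> tail G e"
proof -
  obtain i j where "i < length (snd p)" "snd p ! i = e" "j < length (snd p)" "snd p ! j = f"
    using assms(2,3) by (meson in_set_conv_nth)
  then show ?thesis using proper_route_sorted[OF p] unfolding sorted_wrt_iff_nth_less
    by (metis linorder_neqE_nat)
qed

lemma proper_route_strict:
  assumes p: "p \<in> proper_routes"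
  shows "sorted_wrt (\<lambda>e f. int (tail G e) < int (tail G f)) (snd p)"
    "sorted_wrt (\<lambda>e f. int (head G e) < int (head G f)) (snd p)"
  by (rule sorted_wrt_mono_rel[OF _ proper_route_sorted[OF p]];
      use proper_route_arcs[OF p] tail_less_head in \<open>fastforce simp: order.strict_trans1 order.strict_trans2\<close>)+

lemma proper_route_through_arc:
  assumes "e \<in> arcs G" obtains p where "p \<in> proper_routes" "e \<in> set (snd p)"
proof -
  obtain xs u where x: "set xs \<subseteq> arcs G" "cas u xs (tail G e)" "source u"
    using cas_from_source[of "tail G e"] assms by auto
  obtain ys w where y: "set ys \<subseteq> arcs G" "cas (head G e) ys w" "sink w"
    using cas_to_sink[of "head G e"] assms by auto
  have "cas u (xs @ e # ys) w" using cas_append[OF x(2), of "e # ys" w] y by simp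
  then have "(u, xs @ e # ys) \<in> proper_routes" unfolding proper_routes_iff using x y assms by auto
  then show ?thesis using that by force
qed

lemma finite_proper_routes: "finite proper_routes"
proof (rule finite_subset)
  show "proper_routes \<subseteq> verts G \<times> {xs. set xs \<subseteq> arcs G \<and> distinct xs}"
  proof
    fix p assume p: "p \<in> proper_routes"
    have "distinct (snd p)" using proper_route_strict(1)[OF p]
      unfolding sorted_wrt_map[of "(<)" "\<lambda>e. int (tail G e)", symmetric]
      by (simp add: strict_sorted_iff distinct_map)
    then show "p \<in> verts G \<times> {xs. set xs \<subseteq> arcs G \<and> distinct xs}"
      using p unfolding proper_routes_iff source_def by (cases p) auto
  qed
  show "finite (verts G \<times> {xs. set xs \<subseteq> arcs G \<and> distinct xs})"
    using finite_subset_distinct finite_verts finite_arcs by blast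
qed

lemma proper_route_splice:
  assumes p: "p \<in> proper_routes" and q: "q \<in> proper_routes"
    and e: "e \<in> set (snd p)" "tail G e = v" and f: "f \<in> set (snd q)" "tail G f = v"
  shows "\<exists>r\<in>proper_routes. set (snd r) = {e\<in>set (snd p). tail G e < v} \<union> {e\<in>set (snd q). v \<le> tail G e}"
proof -
  obtain xs ys where s: "snd p = xs @ e # ys" using e by (meson split_list)
  obtain xs' ys' where s': "snd q = xs' @ f # ys'" using f by (meson split_list)
  have a: "set (snd p) \<subseteq> arcs G" "set (snd q) \<subseteq> arcs G" using p q unfolding proper_routes_iff by auto
  have x: "cas (fst p) xs v" "source (fst p)" using p e(2) unfolding proper_routes_iff s by auto
  obtain w where w: "cas v (f # ys') w" "sink w"
    using q f(2) unfolding proper_routes_iff s' by auto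
  have "(fst p, xs @ f # ys') \<in> proper_routes"
    unfolding proper_routes_iff using a s s' cas_append[OF x(1) w(1)] x(2) w(2) by auto
  moreover have "set xs = {e\<in>set (snd p). tail G e < v}"
    using proper_route_strict(1)[OF p] e(2) unfolding s by (fastforce simp: sorted_wrt_append)
  moreover have "set (f # ys') = {e\<in>set (snd q). v \<le> tail G e}"
    using proper_route_strict(1)[OF q] f(2) unfolding s' by (fastforce simp: sorted_wrt_append)
  ultimately show ?thesis by (intro bexI[of _ "(fst p, xs @ f # ys')"]) auto
qed

end

section \<open>Framed graphs as route systems\<close>

context framed_graph
begin

text \<open>The same unions as in \<open>out_lex\<close> and \<open>in_lex\<close>, so that the
  lexicographic comparisons carry over without changing the relation.\<close>

abbreviation "Out_arcs \<equiv> (\<Union>v\<in>{v. internal v}. out_ord v)"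
abbreviation "In_arcs \<equiv> (\<Union>v\<in>{v. internal v}. in_ord v)"

lemma out_ordD: "internal v \<Longrightarrow> (e, f) \<in> out_ord v \<Longrightarrow> e \<in> arcs G \<and> f \<in> arcs G \<and> tail G e = v \<and> tail G f = v"
  using out_ord_subset by fastforce

lemma in_ordD: "internal v \<Longrightarrow> (e, f) \<in> in_ord v \<Longrightarrow> e \<in> arcs G \<and> f \<in> arcs G \<and> head G e = v \<and> head G f = v"
  using in_ord_subset by fastforce

lemma Out_iff: "(e, f) \<in> Out_arcs \<longleftrightarrow> internal (tail G e) \<and> (e, f) \<in> out_ord (tail G e)"
  using out_ordD by auto

lemma In_iff: "(e, f) \<in> In_arcs \<longleftrightarrow> internal (head G e) \<and> (e, f) \<in> in_ord (head G e)"
  using in_ordD by auto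

text \<open>Related arcs share their tail, so both steps take place in the order at a single
  vertex.\<close>

lemma Out_trans: "(e, f) \<in> Out_arcs \<Longrightarrow> (f, g) \<in> Out_arcs \<Longrightarrow> (e, g) \<in> Out_arcs"
proof -
  assume a: "(e, f) \<in> Out_arcs" "(f, g) \<in> Out_arcs"
  have "internal (tail G e)" "(e, f) \<in> out_ord (tail G e)"
    using a(1) unfolding Out_iff by blast+
  moreover from this have "tail G f = tail G e" using out_ordD by blast
  then have "(f, g) \<in> out_ord (tail G e)" using a(2) unfolding Out_iff by simp
  moreover have "trans (out_ord (tail G e))"
    using out_ord_linear \<open>internal (tail G e)\<close> unfolding strict_linear_order_on_def by blast
  ultimately show ?thesis unfolding Out_iff by (meson transD)
qed

lemma In_trans: "(e, f) \<in> In_arcs \<Longrightarrow> (f, g) \<in> In_arcs \<Longrightarrow> (e, g) \<in> In_arcs"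
proof -
  assume a: "(e, f) \<in> In_arcs" "(f, g) \<in> In_arcs"
  have "internal (head G e)" "(e, f) \<in> in_ord (head G e)"
    using a(1) unfolding In_iff by blast+
  moreover from this have "head G f = head G e" using in_ordD by blast
  then have "(f, g) \<in> in_ord (head G e)" using a(2) unfolding In_iff by simp
  moreover have "trans (in_ord (head G e))"
    using in_ord_linear \<open>internal (head G e)\<close> unfolding strict_linear_order_on_def by blast
  ultimately show ?thesis unfolding In_iff by (meson transD)
qed

lemma Out_irrefl: "(e, e) \<notin> Out_arcs"
  unfolding Out_iff using out_ord_linear unfolding strict_linear_order_on_def irrefl_def by blast

lemma In_irrefl: "(e, e) \<notin> In_arcs"
  unfolding In_iff using in_ord_linear unfolding strict_linear_order_on_def irrefl_def by blast

lemma Out_total: "e \<in> arcs G \<Longrightarrow> f \<in> arcs G \<Longrightarrow> tail G e = tail G f \<Longrightarrow> internal (tail G e) \<Longrightarrow> e \<noteq> f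
    \<Longrightarrow> (e, f) \<in> Out_arcs \<or> (f, e) \<in> Out_arcs"
  unfolding Out_iff using out_ord_linear[of "tail G e"] unfolding strict_linear_order_on_def total_on_def by simp

lemma In_total: "e \<in> arcs G \<Longrightarrow> f \<in> arcs G \<Longrightarrow> head G e = head G f \<Longrightarrow> internal (head G e) \<Longrightarrow> e \<noteq> f
    \<Longrightarrow> (e, f) \<in> In_arcs \<or> (f, e) \<in> In_arcs"
  unfolding In_iff using in_ord_linear[of "head G e"] unfolding strict_linear_order_on_def total_on_def by simp

sublocale routes: route_system proper_routes "\<lambda>p. set (snd p)" "\<lambda>e. int (tail G e)" "\<lambda>e. int (head G e)"
  Out_arcs In_arcs
proof (unfold_locales, goal_cases)
  case 1 show ?case by (rule finite_proper_routes)
next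
  case (2 p) show ?case by simp
next
  case (3 p e) then show ?case using tail_less_head proper_route_arcs by simp
next
  case (4 p e f) then show ?case using proper_route_chain[of p e f] by simp
next
  case (5 p e f)
  \<comment> \<open>At a sink the path would end with \<open>e\<close>, so \<open>f\<close> would be
    \<open>e\<close> or precede it, against the assumed position of \<open>f\<close>.\<close>
  have "\<not> sink (head G e)"
  proof
    assume s: "sink (head G e)"
    obtain xs ys where x: "snd p = xs @ e # ys" using 5 by (meson split_list)
    obtain w where w: "cas (head G e) ys w" using 5 unfolding proper_routes_iff x by auto
    have "ys = []"
    proof (cases ys)
      case (Cons g zs)
      then have "tail G g = head G e" "g \<in> arcs G" using w 5 x unfolding proper_routes_iff by auto
      then show ?thesis using s not_sink by metis
    qed simp
    then have "f \<in> set xs \<or> f = e" using 5 x by auto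
    moreover have "head G f \<le> tail G e" if "f \<in> set xs"
      using proper_route_sorted[OF 5(1)] that unfolding x by (simp add: sorted_wrt_append)
    ultimately show False using tail_less_head[of e] tail_less_head[of f] proper_route_arcs[OF 5(1)] 5 by force
  qed
  then show ?case using proper_route_next[OF 5(1,2)] by simp
next
  case (6 p e f)
  have "\<not> source (tail G f)"
  proof
    assume s: "source (tail G f)"
    obtain xs ys where x: "snd p = xs @ f # ys" using 6 by (meson split_list)
    have w: "cas (fst p) xs (tail G f)" using 6 cas_split unfolding proper_routes_iff x by blast
    have "xs = []"
    proof (rule ccontr)
      assume "xs \<noteq> []"
      then have "head G (last xs) = tail G f" "last xs \<in> arcs G"
        using cas_ends_arcs[OF w] 6 x last_in_set[of xs] unfolding proper_routes_iff by auto
      then show False using s not_source by metis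
    qed
    then have "e \<in> set ys \<or> f = e" using 6 x by auto
    moreover have "head G f \<le> tail G e" if "e \<in> set ys"
      using proper_route_sorted[OF 6(1)] that unfolding x by (simp add: sorted_wrt_append)
    ultimately show False using tail_less_head[of e] tail_less_head[of f] proper_route_arcs[OF 6(1)] 6 by force
  qed
  then show ?case using proper_route_previous[OF 6(1,3)] by simp
next
  case (7 p q e f)
  then have "\<not> sink (head G e)" using not_sink[of f] proper_route_arcs by simp
  then show ?case using proper_route_next[OF 7(1,3)] by simp
next
  case (8 p q e f)
  then have "\<not> source (tail G f)" using not_source[of e] proper_route_arcs by simp
  then show ?case using proper_route_previous[OF 8(2,4)] by simp
next
  case (9 p q)
  then have "snd p = snd q" using sorted_wrt_key_unique[OF proper_route_strict(1) proper_route_strict(1)] by blast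
  \<comment> \<open>The recorded first vertex is determined by a nonempty arc list.\<close>
  moreover have "fst p = tail G (hd (snd p))" if "p \<in> proper_routes" for p
    using that cas_ends_arcs(1)[of "fst p" "snd p"] unfolding proper_routes_iff by auto
  ultimately show ?case using 9 by (metis prod_eqI)
next
  case (10 p q v)
  then obtain e f where e: "e \<in> set (snd p)" "int (tail G e) = v" and f: "f \<in> set (snd q)" "int (tail G f) = v"
    by blast
  have "int (tail G g) < v \<longleftrightarrow> tail G g < tail G e" "v \<le> int (tail G g) \<longleftrightarrow> tail G e \<le> tail G g" for g
    using e(2) by auto
  moreover have "tail G f = tail G e" using e f by simp
  ultimately show ?case using proper_route_splice[OF 10(1,2) e(1) refl f(1)] by simp
next
  case (11 e f)
  then have i: "internal (tail G e)" "e \<in> arcs G" "f \<in> arcs G" "tail G f = tail G e"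
    unfolding Out_iff using out_ordD by blast+
  obtain g where g: "g \<in> arcs G" "head G g = tail G e" using internalD(1)[OF i(1)] by blast
  show ?case using proper_route_through_arc[OF i(2)] proper_route_through_arc[OF i(3)] proper_route_through_arc[OF g(1)]
    i g(2) by (metis UN_I)
next
  case (12 e f)
  then have i: "internal (head G e)" "e \<in> arcs G" "f \<in> arcs G" "head G f = head G e"
    unfolding In_iff using in_ordD by blast+
  obtain g where g: "g \<in> arcs G" "tail G g = head G e" using internalD(2)[OF i(1)] by blast
  show ?case using proper_route_through_arc[OF i(2)] proper_route_through_arc[OF i(3)] proper_route_through_arc[OF g(1)]
    i g(2) by (metis UN_I)
next
  case (13 e) show ?case by (rule Out_irrefl)
next
  case (14 e) show ?case by (rule In_irrefl)
next
  case (15 e f g) then show ?case by (rule Out_trans)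
next
  case (16 e f g) then show ?case by (rule In_trans)
next
  case (17 p q e f)
  then have a: "e \<in> arcs G" "f \<in> arcs G" "tail G e = tail G f" using proper_route_arcs by auto
  have "internal (tail G e)" using 17 internalI proper_route_arcs by (metis nat_int)
  then show ?case using Out_total a 17 by blast
next
  case (18 p q e f)
  then have a: "e \<in> arcs G" "f \<in> arcs G" "head G e = head G f" using proper_route_arcs by auto
  have "internal (head G e)" using 18 internalI proper_route_arcs by (metis nat_int)
  then show ?case using In_total a 18 by blast
qed

section \<open>From arc lists to arc sets\<close>

lemma route_proper:
  assumes "route p" "v \<in> path_verts p" "internal v" shows "p \<in> proper_routes"
proof -
  \<comment> \<open>A route without arcs visits only its source, which is not internal.\<close>
  have "snd p \<noteq> []"
  proof
    assume "snd p = []"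
    then have "v = fst p" using assms(2) unfolding path_verts_def by simp
    then show False using assms unfolding route_def internal_def by blast
  qed
  then show ?thesis using assms unfolding proper_routes_def by simp
qed

lemma through_iff:
  assumes p: "p \<in> proper_routes"
  shows "internal v \<and> v \<in> path_verts p \<longleftrightarrow> routes.through p (int v)"
proof
  assume v: "internal v \<and> v \<in> path_verts p"
  have "\<exists>e\<in>set (snd p). tail G e = v"
  proof -
    have ne: "snd p \<noteq> []" using p unfolding proper_routes_iff by blast
    obtain w where w: "cas (fst p) (snd p) w" "sink w" using p unfolding proper_routes_iff by blast
    \<comment> \<open>Being internal, \<open>v\<close> is not the final sink of the path, hence it
      is the tail of one of its arcs.\<close>
    have "v \<noteq> head G (last (snd p))" using cas_ends_arcs(2)[OF w(1) ne] w v unfolding internal_def by auto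
    then show ?thesis using v ne unfolding path_verts_def awalk_verts_conv by auto
  qed
  then obtain e where e: "e \<in> set (snd p)" "tail G e = v" by blast
  then have "\<exists>g\<in>set (snd p). head G g = v" using proper_route_previous[OF p e(1)] v unfolding internal_def by auto
  then show "routes.through p (int v)" using e unfolding routes.through_def by auto
next
  assume "routes.through p (int v)"
  then obtain e f where ef: "e \<in> set (snd p)" "f \<in> set (snd p)" "head G e = v" "tail G f = v"
    unfolding routes.through_def by auto
  then have "internal v" using internalI[of e f v] proper_route_arcs[OF p] by blast
  moreover have "v \<in> tail G ` set (snd p)" using ef(2,4) by auto
  then have "v \<in> path_verts p" unfolding path_verts_def awalk_verts_conv by auto
  ultimately show "internal v \<and> v \<in> path_verts p" by blast
qed

lemma shared_internal_iff:
  assumes "p \<in> proper_routes" "q \<in> proper_routes"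
  shows "shared_internal p q v \<longleftrightarrow> routes.through p (int v) \<and> routes.through q (int v)"
  using through_iff[OF assms(1)] through_iff[OF assms(2)] unfolding shared_internal_def by blast

text \<open>Both list functions cut at the unique arc leaving \<open>v\<close>. Since no arc passes
  over \<open>v\<close>, the parts can be described by heads and by tails respectively.\<close>

lemma split_at:
  assumes p: "p \<in> proper_routes" and v: "routes.through p (int v)"
  shows "snd p = prefix_to v p @ suffix_from v p" "suffix_from v p \<noteq> []"
    "tail G (hd (suffix_from v p)) = v" "prefix_to v p \<noteq> []"
    "set (prefix_to v p) = {g\<in>set (snd p). int (head G g) \<le> int v}"
    "set (suffix_from v p) = {g\<in>set (snd p). int v \<le> int (tail G g)}"
proof -
  obtain e f where e: "e \<in> set (snd p)" "tail G e = v" and f: "f \<in> set (snd p)" "head G f = v"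
    using v unfolding routes.through_def by auto
  obtain xs ys where s: "snd p = xs @ e # ys" using e by (meson split_list)
  have so: "sorted_wrt (\<lambda>e f. head G e \<le> tail G f) (xs @ e # ys)" using proper_route_sorted[OF p] s by simp
  have less: "tail G g < head G g" if "g \<in> set (snd p)" for g
    using that proper_route_arcs[OF p] tail_less_head by blast
  have x: "head G g \<le> v" "tail G g < v" if "g \<in> set xs" for g
    using so that e(2) less[of g] s by (auto simp: sorted_wrt_append)
  have y: "v \<le> tail G g" "v < head G g" if "g \<in> set (e # ys)" for g
    using so that e(2) less[of e] less[of g] s by (auto simp: sorted_wrt_append)
  have "takeWhile (\<lambda>g. tail G g \<noteq> v) (xs @ e # ys) = xs @ takeWhile (\<lambda>g. tail G g \<noteq> v) (e # ys)"
    using x by (intro takeWhile_append2) force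
  then have pre: "prefix_to v p = xs" unfolding prefix_to_def s using e(2) by simp
  have "dropWhile (\<lambda>g. tail G g \<noteq> v) (xs @ e # ys) = dropWhile (\<lambda>g. tail G g \<noteq> v) (e # ys)"
    using x by (intro dropWhile_append2) force
  then have suf: "suffix_from v p = e # ys" unfolding suffix_from_def s using e(2) by simp
  have "f \<in> set xs" using f y(2)[of f] s by auto
  then show "prefix_to v p \<noteq> []" unfolding pre by auto
  show "snd p = prefix_to v p @ suffix_from v p" unfolding pre suf by (rule s)
  show "suffix_from v p \<noteq> []" "tail G (hd (suffix_from v p)) = v" unfolding suf using e(2) by auto
  show "set (prefix_to v p) = {g\<in>set (snd p). int (head G g) \<le> int v}" unfolding pre s using x y by force
  show "set (suffix_from v p) = {g\<in>set (snd p). int v \<le> int (tail G g)}" unfolding suf s using x y by force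
qed

lemma suffix_from_path:
  assumes p: "p \<in> proper_routes" and v: "routes.through p (int v)"
  obtains w where "cas v (suffix_from v p) w" "sink w" "set (suffix_from v p) \<subseteq> arcs G"
proof -
  define e where "e = hd (suffix_from v p)"
  have e: "snd p = prefix_to v p @ suffix_from v p" "suffix_from v p = e # tl (suffix_from v p)" "tail G e = v"
    using split_at(1-3)[OF p v] unfolding e_def by simp_all
  obtain w where w: "cas (fst p) (snd p) w" "sink w" "set (snd p) \<subseteq> arcs G" using p unfolding proper_routes_iff by blast
  have s: "snd p = prefix_to v p @ e # tl (suffix_from v p)" unfolding e(2)[symmetric] by (rule e(1))
  have "cas (head G e) (tl (suffix_from v p)) w" using cas_split(2)[of "fst p"] w(1) unfolding s by blast
  then have "cas v (suffix_from v p) w" by (subst e(2)) (simp add: e(3))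
  moreover have "set (suffix_from v p) \<subseteq> arcs G" using w(3) split_at(6)[OF p v] by auto
  ultimately show ?thesis using that w by blast
qed

lemma prefix_to_path:
  assumes p: "p \<in> proper_routes" and v: "routes.through p (int v)"
  shows "cas (fst p) (prefix_to v p) v" "source (fst p)" "set (prefix_to v p) \<subseteq> arcs G"
proof -
  define e where "e = hd (suffix_from v p)"
  have e: "snd p = prefix_to v p @ suffix_from v p" "suffix_from v p = e # tl (suffix_from v p)" "tail G e = v"
    using split_at(1-3)[OF p v] unfolding e_def by simp_all
  obtain w where w: "cas (fst p) (snd p) w" "source (fst p)" "set (snd p) \<subseteq> arcs G" using p unfolding proper_routes_iff by blast
  have s: "snd p = prefix_to v p @ e # tl (suffix_from v p)" unfolding e(2)[symmetric] by (rule e(1))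
  show "cas (fst p) (prefix_to v p) v" using cas_split(1)[of "fst p" "prefix_to v p" e] w(1) e(3) unfolding s by blast
  show "source (fst p)" by fact
  show "set (prefix_to v p) \<subseteq> arcs G" using w(3) split_at(5)[OF p v] by auto
qed

text \<open>Negating heads makes the key increase along a reversed prefix, so one lemma on sorted
  lists serves both directions.\<close>

lemma strict_parts:
  assumes p: "p \<in> proper_routes" and v: "routes.through p (int v)"
  shows "sorted_wrt (\<lambda>e f. int (tail G e) < int (tail G f)) (suffix_from v p)"
    "sorted_wrt (\<lambda>e f. - int (head G e) < - int (head G f)) (rev (prefix_to v p))"
proof -
  have "sorted_wrt (\<lambda>e f. int (tail G e) < int (tail G f)) (prefix_to v p @ suffix_from v p)"
    unfolding split_at(1)[OF p v, symmetric] by (rule proper_route_strict(1)[OF p])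
  then show "sorted_wrt (\<lambda>e f. int (tail G e) < int (tail G f)) (suffix_from v p)"
    by (simp add: sorted_wrt_append)
  have "sorted_wrt (\<lambda>e f. int (head G e) < int (head G f)) (prefix_to v p @ suffix_from v p)"
    unfolding split_at(1)[OF p v, symmetric] by (rule proper_route_strict(2)[OF p])
  then have "sorted_wrt (\<lambda>e f. int (head G e) < int (head G f)) (prefix_to v p)"
    by (simp add: sorted_wrt_append)
  then show "sorted_wrt (\<lambda>e f. - int (head G e) < - int (head G f)) (rev (prefix_to v p))"
    by (simp add: sorted_wrt_rev)
qed

lemma out_less_iff:
  assumes p: "p \<in> proper_routes" "routes.through p (int v)" and q: "q \<in> proper_routes" "routes.through q (int v)"
  shows "out_less v p q \<longleftrightarrow> routes.out_lt (int v) p q"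
proof -
  note sp = split_at(6)[OF p]
  note sq = split_at(6)[OF q]
  \<comment> \<open>The suffix of \<open>p\<close> already ends at a sink, which the extra arc
    \<open>a\<close> would have to leave.\<close>
  have "suffix_from v q \<noteq> suffix_from v p @ a # x" for a x
  proof
    assume h: "suffix_from v q = suffix_from v p @ a # x"
    obtain w where w: "cas v (suffix_from v p) w" "sink w" using suffix_from_path[OF p] by blast
    note ne = split_at(2)[OF p]
    obtain w' where w': "cas v (suffix_from v q) w'" "set (suffix_from v q) \<subseteq> arcs G" using suffix_from_path[OF q] by blast
    have "cas v (suffix_from v p) (tail G a)" "a \<in> arcs G" using w' cas_split(1) unfolding h by auto
    then have "tail G a = w" using cas_ends_arcs(2)[OF _ ne] w(1) by metis
    then show False using not_sink[OF \<open>a \<in> arcs G\<close>] w by simp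
  qed
  then have "out_less v p q \<longleftrightarrow> (\<exists>e\<in>set (suffix_from v p). \<exists>f\<in>set (suffix_from v q).
      int (tail G e) = int (tail G f) \<and> (e, f) \<in> Out_arcs \<and>
      (\<forall>g. int (tail G g) < int (tail G e) \<longrightarrow> (g \<in> set (suffix_from v p) \<longleftrightarrow> g \<in> set (suffix_from v q))))"
    unfolding out_less_def out_lex_def
    by (intro lexord_iff_first_difference strict_parts p q) (use routes.Out_arcs in blast)+
  also have "\<dots> \<longleftrightarrow> routes.out_lt (int v) p q"
    unfolding routes.out_lt_def sp sq by (rule restricted_first_difference)
  finally show ?thesis .
qed

lemma in_less_iff:
  assumes p: "p \<in> proper_routes" "routes.through p (int v)" and q: "q \<in> proper_routes" "routes.through q (int v)"
  shows "in_less v p q \<longleftrightarrow> routes.in_lt (int v) p q"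
proof -
  note sp = split_at(5)[OF p]
  note sq = split_at(5)[OF q]
  \<comment> \<open>The prefix of \<open>p\<close> already starts at a source, which the extra arc
    \<open>a\<close> would have to enter.\<close>
  have no_prefix: "rev (prefix_to v q) \<noteq> rev (prefix_to v p) @ a # x" for a x
  proof
    assume "rev (prefix_to v q) = rev (prefix_to v p) @ a # x"
    then have h: "prefix_to v q = rev x @ a # prefix_to v p" by (metis append.assoc append_Cons append_Nil rev.simps(2) rev_append rev_rev_ident)
    note ne = split_at(4)[OF p]
    note w = prefix_to_path[OF p] and w' = prefix_to_path[OF q]
    have "cas (head G a) (prefix_to v p) v" "a \<in> arcs G" using w'(1,3) cas_split(2) unfolding h by auto
    then have "head G a = fst p" using cas_ends_arcs(1)[OF _ ne] w(1) by metis
    then show False using not_source[OF \<open>a \<in> arcs G\<close>] w by simp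
  qed
  have "in_less v p q \<longleftrightarrow> (rev (prefix_to v p), rev (prefix_to v q)) \<in> lexord In_arcs"
    unfolding in_less_def in_lex_def by simp
  also have "\<dots> \<longleftrightarrow> (\<exists>e\<in>set (rev (prefix_to v p)). \<exists>f\<in>set (rev (prefix_to v q)).
      - int (head G e) = - int (head G f) \<and> (e, f) \<in> In_arcs \<and>
      (\<forall>g. - int (head G g) < - int (head G e) \<longrightarrow>
        (g \<in> set (rev (prefix_to v p)) \<longleftrightarrow> g \<in> set (rev (prefix_to v q)))))"
    by (intro lexord_iff_first_difference strict_parts p q no_prefix) (use routes.In_arcs in auto)
  also have "\<dots> \<longleftrightarrow> routes.in_lt (int v) p q"
    unfolding routes.in_lt_def set_rev sp sq
    using restricted_first_difference[of "set (snd p)" "- int v" "\<lambda>e. - int (head G e)" "set (snd q)" In_arcs] by simp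
  finally show ?thesis .
qed

lemma suffix_eq_iff:
  assumes p: "p \<in> proper_routes" "routes.through p (int v)" and q: "q \<in> proper_routes" "routes.through q (int v)"
  shows "suffix_from v p = suffix_from v q \<longleftrightarrow> routes.out_eq (int v) p q"
proof -
  note sp = split_at(6)[OF p]
  note sq = split_at(6)[OF q]
  have "suffix_from v p = suffix_from v q \<longleftrightarrow> set (suffix_from v p) = set (suffix_from v q)"
    using sorted_wrt_key_unique[OF strict_parts(1)[OF p] strict_parts(1)[OF q]] by auto
  also have "\<dots> \<longleftrightarrow> routes.out_eq (int v) p q" unfolding routes.out_eq_def sp sq by auto
  finally show ?thesis .
qed

lemma prefix_eq_iff:
  assumes p: "p \<in> proper_routes" "routes.through p (int v)" and q: "q \<in> proper_routes" "routes.through q (int v)"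
  shows "prefix_to v p = prefix_to v q \<longleftrightarrow> routes.in_eq (int v) p q"
proof -
  note sp = split_at(5)[OF p]
  note sq = split_at(5)[OF q]
  have "prefix_to v p = prefix_to v q \<longleftrightarrow> set (prefix_to v p) = set (prefix_to v q)"
    using sorted_wrt_key_unique[OF strict_parts(2)[OF p] strict_parts(2)[OF q]] by auto
  also have "\<dots> \<longleftrightarrow> routes.in_eq (int v) p q" unfolding routes.in_eq_def sp sq by auto
  finally show ?thesis .
qed

lemma clockwise_at_iff:
  assumes "p \<in> proper_routes" "q \<in> proper_routes"
  shows "clockwise_at v p q \<longleftrightarrow> routes.clockwise (int v) p q"
  using shared_internal_iff[OF assms] in_less_iff[OF assms(1) _ assms(2)] out_less_iff[OF assms(2) _ assms(1)]
  unfolding clockwise_at_def routes.clockwise_def by blast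

lemma coherent_iff:
  assumes "p \<in> proper_routes" "q \<in> proper_routes"
  shows "coherent p q \<longleftrightarrow> routes.coherent p q"
proof -
  \<comment> \<open>Abstract vertices range over all integers, but a vertex of conflict is the head
    of an arc and so comes from a natural number.\<close>
  have nonneg: "k = int (nat k)" if "routes.conflict k p q" for k
    using that unfolding routes.conflict_def routes.clockwise_def routes.through_def by auto
  have at: "(shared_internal p q v \<longrightarrow> \<not> clockwise_at v p q \<and> \<not> clockwise_at v q p)
      \<longleftrightarrow> \<not> routes.conflict (int v) p q" for v
    using clockwise_at_iff[OF assms, of v] clockwise_at_iff[OF assms(2,1), of v]
    unfolding routes.conflict_def clockwise_at_def shared_internal_def by blast
  have "(\<forall>v. \<not> routes.conflict (int v) p q) \<longleftrightarrow> (\<forall>k. \<not> routes.conflict k p q)"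
    using nonneg by metis
  then show ?thesis unfolding coherent_def routes.coherent_def using at by simp
qed

lemma coherent_improper:
  assumes "route p" "route q" "p \<notin> proper_routes \<or> q \<notin> proper_routes" shows "coherent p q"
  using assms route_proper unfolding coherent_def shared_internal_def by blast

text \<open>Routes without arcs are coherent with every route, so coherence with the remaining
  routes of \<open>D\<close> already gives coherence with all of \<open>D\<close>.\<close>

lemma maximal_clique_proper:
  assumes D: "maximal_clique D" shows "routes.maximal_clique (D \<inter> proper_routes)"
proof -
  have c: "\<forall>p\<in>D. route p" "\<forall>p\<in>D. \<forall>q\<in>D. coherent p q"
    using D unfolding maximal_clique_def clique_def by auto
  have "p \<in> D" if p: "p \<in> proper_routes" and coh: "\<forall>q\<in>D \<inter> proper_routes. routes.coherent p q" for p
  proof -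
    have rp: "route p" using p unfolding proper_routes_def by blast
    have pq: "coherent p q \<and> coherent q p" if q: "q \<in> D" for q
    proof (cases "q \<in> proper_routes")
      case True then show ?thesis using coherent_iff coh p q routes.coherent_sym by blast
    next
      case False then show ?thesis using coherent_improper rp c(1) q by blast
    qed
    moreover have "coherent p p" using coherent_iff routes.coherent_refl p by blast
    ultimately have "clique (insert p D)" using c rp unfolding clique_def by blast
    then show ?thesis using D unfolding maximal_clique_def by blast
  qed
  moreover have "routes.clique (D \<inter> proper_routes)" unfolding routes.clique_def using c(2) coherent_iff by blast
  ultimately show ?thesis unfolding routes.maximal_clique_def by blast
qed

section \<open>Corners and coordinates\<close>

lemma left_corner_iff: "left_corner (v, a, b) \<longleftrightarrow> routes.corner a b \<and> v = head G a"
proof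
  assume l: "left_corner (v, a, b)"
  then have v: "internal v" "(a, b) \<in> in_ord v" "\<nexists>e. (a, e) \<in> in_ord v \<and> (e, b) \<in> in_ord v" by auto
  then have h: "head G a = v" "head G b = v" using in_ordD by blast+
  \<comment> \<open>An arc between \<open>a\<close> and \<open>b\<close> in the union also enters
    \<open>v\<close>, so being consecutive there and at \<open>v\<close> is the same.\<close>
  have "head G e = v" if "(a, e) \<in> In_arcs" for e using routes.In_arcs[OF that] h by simp
  then show "routes.corner a b \<and> v = head G a" unfolding routes.corner_def In_iff using v h by metis
next
  assume r: "routes.corner a b \<and> v = head G a"
  then have v: "internal v" "(a, b) \<in> in_ord v" unfolding routes.corner_def In_iff by auto
  have "(a, e) \<in> In_arcs \<and> (e, b) \<in> In_arcs" if "(a, e) \<in> in_ord v" "(e, b) \<in> in_ord v" for e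
    using that v(1) by blast
  then show "left_corner (v, a, b)" using r v unfolding routes.corner_def by auto
qed

lemma route_le_iff:
  assumes "p \<in> proper_routes" "routes.through p (int v)" "q \<in> proper_routes" "routes.through q (int v)"
  shows "route_le v p q \<longleftrightarrow> routes.le (int v) p q"
  unfolding route_le_def in_le_def out_le_def routes.le_def
  using in_less_iff[OF assms] out_less_iff[OF assms] suffix_eq_iff[OF assms] prefix_eq_iff[OF assms] by simp

lemma proper_through_corner:
  assumes "route p" "left_corner (v, a, b)" "e \<in> set (snd p)" "e = a \<or> e = b"
  shows "p \<in> proper_routes" "routes.through p (int v)"
proof -
  show p: "p \<in> proper_routes" using assms unfolding proper_routes_def by force
  have "(a, b) \<in> In_arcs" "int v = int (head G a)" using assms(2) left_corner_iff unfolding routes.corner_def by auto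
  then show "routes.through p (int v)" using routes.through_In[OF p _ assms(3,4)] by simp
qed

text \<open>Antisymmetry of \<open>le\<close> on routes through the corner makes the definite
  description unambiguous, here and for the lower route.\<close>

lemma upper_cornering_route_eq:
  assumes D: "maximal_clique D" and c: "left_corner (v, a, b)" and u: "routes.upper (D \<inter> proper_routes) b u"
  shows "upper_cornering_route D (v, a, b) = u"
proof -
  have rt: "\<forall>p\<in>D. route p" using D unfolding maximal_clique_def clique_def by blast
  have "(a, b) \<in> In_arcs" "v = head G a" using c left_corner_iff unfolding routes.corner_def by auto
  then have hb: "int (head G b) = int v" using routes.In_arcs[of a b] by simp
  have thru: "p \<in> proper_routes" "routes.through p (int v)" if "p \<in> D" "b \<in> set (snd p)" for p
    using proper_through_corner[OF _ c, of p b] rt that by auto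
  have le_iff: "route_le v p q \<longleftrightarrow> routes.le (int v) p q"
    if "p \<in> D" "b \<in> set (snd p)" "q \<in> D" "b \<in> set (snd q)" for p q
    using route_le_iff thru[OF that(1,2)] thru[OF that(3,4)] by blast
  have u': "u \<in> D" "b \<in> set (snd u)" and min: "\<forall>q\<in>D. b \<in> set (snd q) \<longrightarrow> routes.le (int v) u q"
    using u thru hb unfolding routes.upper_def by auto
  have "(THE r. r \<in> D \<and> b \<in> set (snd r) \<and> (\<forall>q\<in>D. b \<in> set (snd q) \<longrightarrow> route_le v r q)) = u"
  proof (rule the_equality)
    show "u \<in> D \<and> b \<in> set (snd u) \<and> (\<forall>q\<in>D. b \<in> set (snd q) \<longrightarrow> route_le v u q)"
      using u' min le_iff by simp
  next
    fix r assume r: "r \<in> D \<and> b \<in> set (snd r) \<and> (\<forall>q\<in>D. b \<in> set (snd q) \<longrightarrow> route_le v r q)"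
    have "routes.le (int v) r u" "routes.le (int v) u r" using u' min r le_iff[of r u] by simp_all
    then show "r = u" using routes.le_antisym[OF thru(1) thru(1) thru(2) thru(2)] r u' by blast
  qed
  then show ?thesis by simp
qed

lemma lower_cornering_route_eq:
  assumes D: "maximal_clique D" and c: "left_corner (v, a, b)" and l: "routes.lower (D \<inter> proper_routes) a l"
  shows "lower_cornering_route D (v, a, b) = l"
proof -
  have rt: "\<forall>p\<in>D. route p" using D unfolding maximal_clique_def clique_def by blast
  have ha: "int (head G a) = int v" using c left_corner_iff by simp
  have thru: "p \<in> proper_routes" "routes.through p (int v)" if "p \<in> D" "a \<in> set (snd p)" for p
    using proper_through_corner[OF _ c, of p a] rt that by auto
  have le_iff: "route_le v p q \<longleftrightarrow> routes.le (int v) p q"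
    if "p \<in> D" "a \<in> set (snd p)" "q \<in> D" "a \<in> set (snd q)" for p q
    using route_le_iff thru[OF that(1,2)] thru[OF that(3,4)] by blast
  have l': "l \<in> D" "a \<in> set (snd l)" and max: "\<forall>q\<in>D. a \<in> set (snd q) \<longrightarrow> routes.le (int v) q l"
    using l thru ha unfolding routes.lower_def by auto
  have "(THE r. r \<in> D \<and> a \<in> set (snd r) \<and> (\<forall>q\<in>D. a \<in> set (snd q) \<longrightarrow> route_le v q r)) = l"
  proof (rule the_equality)
    show "l \<in> D \<and> a \<in> set (snd l) \<and> (\<forall>q\<in>D. a \<in> set (snd q) \<longrightarrow> route_le v q l)"
      using l' max le_iff by simp
  next
    fix r assume r: "r \<in> D \<and> a \<in> set (snd r) \<and> (\<forall>q\<in>D. a \<in> set (snd q) \<longrightarrow> route_le v q r)"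
    have "routes.le (int v) r l" "routes.le (int v) l r" using l' max r le_iff[of l r] by simp_all
    then show "r = l" using routes.le_antisym[OF thru(1) thru(1) thru(2) thru(2)] r l' by blast
  qed
  then show ?thesis by simp
qed

text \<open>The first claim, from \<open>upper_lower_out_eq\<close>, gives the description in
  \<open>left_cornered_route_of\<close> a value. The coordinate can then be computed from whichever
  cornering route is at hand.\<close>

lemma CC_L_eq:
  assumes D: "maximal_clique D" and c: "left_corner (v, a, b)"
    and u: "routes.upper (D \<inter> proper_routes) b u" and l: "routes.lower (D \<inter> proper_routes) a l"
  shows "suffix_from v u = suffix_from v l"
    and "CC_L D (v, a, b) = card {\<sigma> \<in> left_cornered_routes (v, a, b). (suffix_from v u, snd \<sigma>) \<in> out_lex}"
proof -
  have cor: "routes.corner a b" "v = head G a" using c left_corner_iff by auto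
  then have hb: "int (head G b) = int v" using routes.In_arcs[of a b] unfolding routes.corner_def by simp
  have "routes.out_eq (int v) u l"
    using routes.upper_lower_out_eq[OF maximal_clique_proper[OF D] cor(1) u l] hb by simp
  moreover have "u \<in> proper_routes" "b \<in> set (snd u)" "l \<in> proper_routes" "a \<in> set (snd l)"
    using u l unfolding routes.upper_def routes.lower_def by auto
  moreover from this have "routes.through u (int v)" "routes.through l (int v)"
    using proper_through_corner(2)[OF _ c] unfolding proper_routes_def by blast+
  ultimately show eq: "suffix_from v u = suffix_from v l" using suffix_eq_iff by blast
  have "snd (left_cornered_route_of D (v, a, b)) = suffix_from v u"
    unfolding left_cornered_route_of_def upper_cornering_route_eq[OF D c u] lower_cornering_route_eq[OF D c l]
    using eq by simp
  then show "CC_L D (v, a, b) = card {\<sigma> \<in> left_cornered_routes (v, a, b). (suffix_from v u, snd \<sigma>) \<in> out_lex}"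
    unfolding CC_L_def by simp
qed

lemma finite_left_cornered_routes: "finite (left_cornered_routes c)"
proof -
  have "left_cornered_routes c \<subseteq> Pair c ` {t. set t \<subseteq> arcs G \<and> distinct t}"
  proof
    fix x assume "x \<in> left_cornered_routes c"
    then obtain t w where t: "x = (c, t)" "awalk (fst c) t w" unfolding left_cornered_routes_def by blast
    then have ta: "set t \<subseteq> arcs G" "cas (fst c) t w" by auto
    have "sorted_wrt (\<lambda>e f. head G e \<le> tail G f) t" using cas_sorted ta by blast
    then have "sorted_wrt (\<lambda>e f. tail G e < tail G f) t"
      by (rule sorted_wrt_mono_rel[rotated]) (use ta(1) tail_less_head in fastforce)
    then have "distinct t"
      unfolding sorted_wrt_map[of "(<)" "tail G", symmetric] by (simp add: strict_sorted_iff distinct_map)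
    then show "x \<in> Pair c ` {t. set t \<subseteq> arcs G \<and> distinct t}" using t ta by simp
  qed
  then show ?thesis using finite_subset_distinct[OF finite_arcs] finite_subset by blast
qed

lemma out_lex_trans: "(x, y) \<in> out_lex \<Longrightarrow> (y, z) \<in> out_lex \<Longrightarrow> (x, z) \<in> out_lex"
proof -
  have "trans (lexord Out_arcs)" by (rule lexord_transI, rule transI, rule Out_trans)
  then show "(x, y) \<in> out_lex \<Longrightarrow> (y, z) \<in> out_lex \<Longrightarrow> (x, z) \<in> out_lex"
    unfolding out_lex_def by (meson transD)
qed

lemma out_lex_irrefl: "(x, x) \<notin> out_lex"
  unfolding out_lex_def by (rule lexord_irreflexive) (use Out_irrefl in blast)

text \<open>By transitivity everything above \<open>t\<close> is above \<open>s\<close>, and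
  \<open>t\<close> itself is counted only for \<open>s\<close>. Finiteness makes the inclusion
  strict on cardinalities.\<close>

lemma corank_less:
  assumes "(s, t) \<in> out_lex" "(c, t) \<in> left_cornered_routes c"
  shows "card {\<sigma> \<in> left_cornered_routes c. (t, snd \<sigma>) \<in> out_lex}
    < card {\<sigma> \<in> left_cornered_routes c. (s, snd \<sigma>) \<in> out_lex}"
proof (rule psubset_card_mono)
  show "finite {\<sigma> \<in> left_cornered_routes c. (s, snd \<sigma>) \<in> out_lex}" using finite_left_cornered_routes by simp
  have "(c, t) \<in> {\<sigma> \<in> left_cornered_routes c. (s, snd \<sigma>) \<in> out_lex}"
    "(c, t) \<notin> {\<sigma> \<in> left_cornered_routes c. (t, snd \<sigma>) \<in> out_lex}"
    using assms out_lex_irrefl by auto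
  moreover have "{\<sigma> \<in> left_cornered_routes c. (t, snd \<sigma>) \<in> out_lex}
      \<subseteq> {\<sigma> \<in> left_cornered_routes c. (s, snd \<sigma>) \<in> out_lex}"
    using out_lex_trans[OF assms(1)] by blast
  ultimately show "{\<sigma> \<in> left_cornered_routes c. (t, snd \<sigma>) \<in> out_lex}
      \<subset> {\<sigma> \<in> left_cornered_routes c. (s, snd \<sigma>) \<in> out_lex}" by blast
qed

lemma framing_cover_CC_L:
  assumes "framing_cover D D'"
  obtains c where "left_corner c" "CC_L D c < CC_L D' c"
    "\<And>c'. left_corner c' \<Longrightarrow> c' \<noteq> c \<Longrightarrow> CC_L D c' = CC_L D' c'"
proof -
  obtain r r' v where D: "maximal_clique D" "maximal_clique D'" and diff: "D - D' = {r}" "D' - D = {r'}"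
    and cw: "clockwise_at v r r'"
    using assms unfolding framing_cover_def clockwise_at_subroute_def by blast
  have rt: "\<forall>p\<in>D. route p" "\<forall>p\<in>D'. route p" using D unfolding maximal_clique_def clique_def by auto
  have mem: "r \<in> D" "r' \<in> D'" using diff by auto
  have rR: "r \<in> proper_routes" "r' \<in> proper_routes"
    using cw route_proper rt mem unfolding clockwise_at_def shared_internal_def by blast+
  define E where "E = D \<inter> proper_routes"
  define E' where "E' = D' \<inter> proper_routes"
  have M: "routes.maximal_clique E" "routes.maximal_clique E'"
    using maximal_clique_proper D unfolding E_def E'_def by auto
  \<comment> \<open>Both exchanged routes share an internal vertex, so they have arcs and survive
    the restriction to \<open>proper_routes\<close>.\<close>
  have dE: "E - E' = {r}" "E' - E = {r'}" using diff rR unfolding E_def E'_def by blast+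
  have cw': "routes.clockwise (int v) r r'" using cw clockwise_at_iff rR by blast
  obtain a b where ab: "routes.corner a b" "routes.lower E a r" "routes.upper E' b r'"
    "routes.out_lt (int (head G b)) r' r"
    and other: "\<And>a' b' u u'. routes.corner a' b' \<Longrightarrow> (a', b') \<noteq> (a, b) \<Longrightarrow> routes.upper E b' u
      \<Longrightarrow> routes.upper E' b' u' \<Longrightarrow> routes.out_eq (int (head G b')) u u'"
    using routes.changed_corner[OF M dE cw'] by blast
  define w where "w = head G a"
  have c: "left_corner (w, a, b)" using ab(1) left_corner_iff w_def by blast
  have hb: "head G b = w" using routes.In_arcs[of a b] ab(1) unfolding routes.corner_def w_def by simp
  have inIn: "(a, b) \<in> In_arcs" using ab(1) unfolding routes.corner_def by blast
  obtain u l' where u: "routes.upper E b u" and l': "routes.lower E' a l'"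
    using routes.exists_upper[OF M(1) inIn] routes.exists_lower[OF M(2) inIn] by blast
  have thr: "routes.through r (int w)" "routes.through r' (int w)"
    using proper_through_corner(2)[OF _ c] rt mem ab(2,3) unfolding routes.lower_def routes.upper_def by blast+
  have lt: "(suffix_from w r', suffix_from w r) \<in> out_lex"
    using out_less_iff[OF rR(2) thr(2) rR(1) thr(1)] ab(4) hb unfolding out_less_def by simp
  have "((w, a, b), suffix_from w r) \<in> left_cornered_routes (w, a, b)"
  proof -
    obtain z where "cas w (suffix_from w r) z" "sink z" "set (suffix_from w r) \<subseteq> arcs G"
      using suffix_from_path[OF rR(1) thr(1)] .
    moreover have "w \<in> verts G" using c unfolding left_corner.simps internal_def by blast
    ultimately show ?thesis unfolding left_cornered_routes_def awalk_def by auto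
  qed
  note r_path = this
  \<comment> \<open>\<open>D\<close> is evaluated through its lower cornering route \<open>r\<close>
    and \<open>D'\<close> through its upper one \<open>r'\<close>, so the coordinates compare the
    suffixes of the exchanged routes.\<close>
  have "CC_L D (w, a, b) = card {\<sigma> \<in> left_cornered_routes (w, a, b). (suffix_from w r, snd \<sigma>) \<in> out_lex}"
    using CC_L_eq[OF D(1) c u[unfolded E_def] ab(2)[unfolded E_def]] by simp
  moreover have "CC_L D' (w, a, b) = card {\<sigma> \<in> left_cornered_routes (w, a, b). (suffix_from w r', snd \<sigma>) \<in> out_lex}"
    using CC_L_eq(2)[OF D(2) c ab(3)[unfolded E'_def] l'[unfolded E'_def]] .
  ultimately have less: "CC_L D (w, a, b) < CC_L D' (w, a, b)"
    using corank_less[OF lt r_path] by simp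
  have "CC_L D c' = CC_L D' c'" if c': "left_corner c'" "c' \<noteq> (w, a, b)" for c'
  proof -
    obtain x a' b' where x: "c' = (x, a', b')" by (cases c') auto
    have cor: "routes.corner a' b'" "x = head G a'" using c'(1) left_corner_iff unfolding x by auto
    then have "(a', b') \<noteq> (a, b)" using c'(2) x w_def by auto
    have in': "(a', b') \<in> In_arcs" using cor unfolding routes.corner_def by blast
    then have hb': "head G b' = x" using routes.In_arcs[of a' b'] cor(2) by simp
    obtain u u' l l' where ul: "routes.upper E b' u" "routes.upper E' b' u'" "routes.lower E a' l" "routes.lower E' a' l'"
      using routes.exists_upper[OF M(1) in'] routes.exists_upper[OF M(2) in']
        routes.exists_lower[OF M(1) in'] routes.exists_lower[OF M(2) in'] by blast
    have "routes.out_eq (int x) u u'" using other[OF cor(1) \<open>(a', b') \<noteq> (a, b)\<close> ul(1,2)] hb' by simp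
    moreover have up: "u \<in> proper_routes" "b' \<in> set (snd u)" "u' \<in> proper_routes" "b' \<in> set (snd u')"
      using ul unfolding routes.upper_def E_def E'_def by auto
    moreover have "routes.through u (int x)" "routes.through u' (int x)"
      using proper_through_corner(2)[OF _ c'(1)[unfolded x]] up unfolding proper_routes_def by blast+
    ultimately have "suffix_from x u = suffix_from x u'" using suffix_eq_iff by blast
    then show ?thesis unfolding x
      using CC_L_eq(2)[OF D(1) c'(1)[unfolded x] ul(1,3)[unfolded E_def]]
        CC_L_eq(2)[OF D(2) c'(1)[unfolded x] ul(2,4)[unfolded E'_def]] by simp
  qed
  then show ?thesis using that[OF c less] by blast
qed

end

theorem theorem4p4:
  fixes G :: "(nat, 'e) pre_digraph" and n :: nat
    and in_ord out_ord :: "nat \<Rightarrow> 'e rel"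
    and D D' :: "(nat \<times> 'e list) set"
  assumes "framed_graph G n in_ord out_ord"
    and "framed_graph.framing_cover G in_ord out_ord D D'"
  shows "(\<exists>!c. framed_graph.left_corner G in_ord c \<and>
              framed_graph.CC_L G in_ord out_ord D c \<noteq> framed_graph.CC_L G in_ord out_ord D' c) \<and>
         (\<forall>c. framed_graph.left_corner G in_ord c \<and>
              framed_graph.CC_L G in_ord out_ord D c \<noteq> framed_graph.CC_L G in_ord out_ord D' c \<longrightarrow>
              framed_graph.CC_L G in_ord out_ord D c < framed_graph.CC_L G in_ord out_ord D' c)"
proof -
  interpret framed_graph G n in_ord out_ord by fact
  obtain c where c: "left_corner c" "CC_L D c < CC_L D' c"
    and other: "\<And>c'. left_corner c' \<Longrightarrow> c' \<noteq> c \<Longrightarrow> CC_L D c' = CC_L D' c'"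
    using framing_cover_CC_L[OF assms(2)] by blast
  have unique: "c' = c" if "left_corner c' \<and> CC_L D c' \<noteq> CC_L D' c'" for c'
    using other that by blast
  show ?thesis using c unique by (intro conjI ex1I[of _ c]) auto
qed

end
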